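(* Let $x\in(0,1)$, $f\in B([0,1])$, $g=f_x$ and $n\in\mathbb{N}$. Then $$\left|B_n(f,x)-\frac{f(x+)+f(x-)}{2}\right|\leq a_n(x)|f(x)-f(x-)|+b_n(x)|f(x+)-f(x-)|$$ $$+2 \exp\left(\frac{x(1-x)}{2}\left(1+\frac{x^2+(1-x)^2}{3\sqrt{n}}\, \exp\left(\frac{1}{\sqrt{n}}\right)\right)\right)\times \frac{1}{n}\sum_{k=0}^{n-1}\omega\left(g,\frac{1}{\sqrt{n}}\log \frac{n}{k}\right).$$
   Context: $\mathbb{N}$ is the set of positive integers and $1_A$ denotes the indicator function of $A$. The Bernstein polynomials are $$B_n(f,x)=\sum_{k=0}^{n}f\left(\frac{k}{n}\right)\binom{n}{k}x^k(1-x)^{n-k}.$$ For fixed $x\in(0,1)$, $B([0,1])$ is the set of all measurable bounded functions $f:[0,1]\to\mathbb{R}$ whose right and left limits at $x$, denoted $f(x+)$ and $f(x-)$, exist and are finite. The function $g=f_x$ associated to $f$ is $$f_x(y)=(f(y)-f(x+))1_{(x,1]}(y)+(f(y)-f(x-))1_{[0,x)}(y),\quad y\in[0,1],$$ so $g(x)=0$, and $$\omega(g,\theta)=\sup\{|g(x+u)-g(x)|:\ x+u\in[0,1],\ |u|\leq\theta\},\quad\theta\geq0.$$ Convention: for $k=0$, $\log\frac{n}{0}=\log\infty=\infty$, and $\omega(g,\infty)=\lim_{\theta\to\infty}\omega(g,\theta)$. Moreover, $$a_n(x)=\frac{1}{\sqrt{2\pi nx(1-x)}}1_{A_n}(x),\quad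 A_n=\left\{\frac{k}{n}:k=1,\ldots,n-1\right\},$$ $$b_n(x)=\left|\frac{1}{2}-(1-x)^n\right|1_{(0,\frac{1}{n})}(x)+\left|\frac{1}{2}-x^n\right|1_{[\frac{n-1}{n},1)}(x)+0.4690\,\frac{x^2+(1-x)^2}{\sqrt{n x(1-x)}}1_{[\frac{1}{n},\frac{n-1}{n})}(x).$$ *)

theory Defs
  imports "HOL-Analysis.Analysis"
begin

definition bernstein_op :: "nat \<Rightarrow> (real \<Rightarrow> real) \<Rightarrow> real \<Rightarrow> real" where
  "bernstein_op n f x = (\<Sum>k\<le>n. f (real k / real n) * Bernstein n k x)"

text \<open>Functions on \<open>[0,1]\<close> are represented by total functions on the reals, of which only the
  values on \<open>[0,1]\<close> matter; for \<open>0 < x < 1\<close> the one-sided limits at \<open>x\<close> depend on those values only.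
  Measurability is Borel measurability.\<close>

definition right_lim :: "(real \<Rightarrow> real) \<Rightarrow> real \<Rightarrow> real" where
  "right_lim f x = Lim (at_right x) f"

definition left_lim :: "(real \<Rightarrow> real) \<Rightarrow> real \<Rightarrow> real" where
  "left_lim f x = Lim (at_left x) f"

definition one_sided_limit_space :: "real \<Rightarrow> (real \<Rightarrow> real) set" where
  "one_sided_limit_space x =
     {f. f \<in> borel_measurable (restrict_space borel {0..1}) \<and> bounded (f ` {0..1}) \<and>
         (\<exists>l. (f \<longlongrightarrow> l) (at_right x)) \<and> (\<exists>l. (f \<longlongrightarrow> l) (at_left x))}"

definition jump_removed :: "(real \<Rightarrow> real) \<Rightarrow> real \<Rightarrow> real \<Rightarrow> real" where
  "jump_removed f x y =
     (f y - right_lim f x) * indicator {x<..1} y + (f y - left_lim f x) * indicator {0..<x} y"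

definition modulus_at :: "(real \<Rightarrow> real) \<Rightarrow> real \<Rightarrow> real \<Rightarrow> real" where
  "modulus_at g x \<theta> = (SUP u\<in>{u. x + u \<in> {0..1} \<and> \<bar>u\<bar> \<le> \<theta>}. \<bar>g (x + u) - g x\<bar>)"

definition modulus_at_ext :: "(real \<Rightarrow> real) \<Rightarrow> real \<Rightarrow> ereal \<Rightarrow> real" where
  "modulus_at_ext g x \<theta> =
     (if \<theta> = \<infinity> then Lim at_top (modulus_at g x) else modulus_at g x (real_of_ereal \<theta>))"

text \<open>\<open>log (n / k)\<close> with the convention \<open>log (n / 0) = \<infinity>\<close>; only used for \<open>k < n\<close>.\<close>

definition log_ratio :: "nat \<Rightarrow> nat \<Rightarrow> ereal" where
  "log_ratio n k = (if k = 0 then \<infinity> else ereal (ln (real n / real k)))"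

definition coeff_a :: "nat \<Rightarrow> real \<Rightarrow> real" where
  "coeff_a n x =
     1 / sqrt (2 * pi * real n * x * (1 - x)) * indicator ((\<lambda>k. real k / real n) ` {1..n - 1}) x"

definition coeff_b :: "nat \<Rightarrow> real \<Rightarrow> real" where
  "coeff_b n x =
     \<bar>1 / 2 - (1 - x) ^ n\<bar> * indicator {0<..<1 / real n} x
   + \<bar>1 / 2 - x ^ n\<bar> * indicator {(real n - 1) / real n..<1} x
   + 0.4690 * ((x\<^sup>2 + (1 - x)\<^sup>2) / sqrt (real n * x * (1 - x)))
       * indicator {1 / real n..<(real n - 1) / real n} x"

end

theory Submission
  imports Defs
begin

text \<open>Write \<open>S\<close> for a binomial variable with parameters \<open>n\<close> and \<open>x\<close>, so that \<open>Bernstein n k x\<close> is the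
  probability of \<open>S = k\<close> and the Bernstein polynomial of \<open>f\<close> is the mean of \<open>f (S / n)\<close>. Splitting
  \<open>f = g + f(x+) 1_(x,1] + f(x-) 1_[0,x) + f(x) 1_{x}\<close> gives the exact identity
  \<open>bernstein_op_decomposition\<close>: the error is the mean of \<open>g (S / n)\<close>, plus \<open>f x - f(x-)\<close> times the
  probability of \<open>S = n x\<close>, plus \<open>f(x+) - f(x-)\<close> times the excess over \<open>1/2\<close> of the probability of
  \<open>S > n x\<close>. The three terms are bounded separately.

  The mean of \<open>g (S / n)\<close>. Let \<open>T = sqrt n * \<bar>S / n - x\<bar>\<close>. Since the modulus of continuity is nondecreasing,
  every index \<open>k < n exp (-T)\<close> contributes at least \<open>\<bar>g (S / n)\<bar>\<close> to the sum over \<open>k\<close> on the right-hand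
  side, and there are at least \<open>n exp (-T)\<close> such indices. Hence \<open>\<bar>g (S / n)\<bar>\<close> is at most
  \<open>exp T\<close> times the average, pointwise (\<open>modulus_at_le_exp_average\<close>), and the exponential factor of the
  theorem is a bound on the mean of \<open>exp T\<close> (\<open>Bernstein_exp_abs_moment_le\<close>).

  The probability of \<open>S = n x\<close>. It vanishes unless \<open>n x\<close> is an integer \<open>m\<close>, and then it is bounded by its
  Gaussian value, because \<open>n! exp n / (sqrt n * n^n)\<close> decreases to \<open>sqrt (2 pi)\<close>
  (\<open>Bernstein_integer_mean_le\<close>).

  The probability of \<open>S > n x\<close>. Near the end points of \<open>[0,1]\<close> the coefficient is its exact distance to
  \<open>1/2\<close>. In between a bound of Berry-Esseen type is needed at the single point \<open>n x\<close> only, and no normal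
  approximation enters. If \<open>p = m / n \<le> 1/2\<close> and \<open>q = 1 - p\<close>, the distribution function has derivative
  \<open>- Bernstein n m t * (n - m) / (1 - t)\<close>, and comparing the right and the left branch of
  \<open>t \<mapsto> t^m (1 - t)^(n - m)\<close> along the Moebius map \<open>u \<mapsto> u / (1 + c u)\<close> shows that the probabilities of
  \<open>S \<le> m\<close> and \<open>S \<ge> m\<close> differ by a number between \<open>0\<close> and \<open>(q - p) / 2 * Bernstein n m p\<close>
  (\<open>integer_mean_cdf_gap_nonneg\<close>, \<open>integer_mean_cdf_gap_le\<close>). Together with the local bound this settles
  integer means with room to spare in the constant, and the room pays for moving \<open>x\<close> between
  two consecutive multiples of \<open>1 / n\<close> (\<open>bin_cdf_at_mean_near_half\<close>).\<close>

section \<open>The part without jump\<close>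

lemma modulus_at_upper:
  assumes "bounded (g ` {0..1})" "x + u \<in> {0..1}" "\<bar>u\<bar> \<le> \<theta>"
  shows "\<bar>g (x + u) - g x\<bar> \<le> modulus_at g x \<theta>"
  unfolding modulus_at_def
proof (rule cSUP_upper)
  obtain K where K: "\<forall>y\<in>{0..1}. \<bar>g y\<bar> \<le> K"
    using assms(1) by (auto simp: bounded_iff)
  show "bdd_above ((\<lambda>u. \<bar>g (x + u) - g x\<bar>) ` {u. x + u \<in> {0..1} \<and> \<bar>u\<bar> \<le> \<theta>})"
  proof (rule bdd_aboveI2)
    fix v assume "v \<in> {u. x + u \<in> {0..1} \<and> \<bar>u\<bar> \<le> \<theta>}"
    then show "\<bar>g (x + v) - g x\<bar> \<le> K + \<bar>g x\<bar>" using bspec[OF K, of "x + v"] by auto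
  qed
qed (use assms in auto)

lemma modulus_at_nonneg:
  assumes "bounded (g ` {0..1})" "0 \<le> x" "x \<le> 1" "0 \<le> \<theta>"
  shows "0 \<le> modulus_at g x \<theta>"
  using modulus_at_upper[OF assms(1), of x 0 \<theta>] assms by simp

lemma modulus_at_ext_infinity:
  assumes "0 \<le> x" "x \<le> 1"
  shows "modulus_at_ext g x \<infinity> = modulus_at g x 1"
proof -
  have "modulus_at g x \<theta> = modulus_at g x 1" if "1 \<le> \<theta>" for \<theta>
  proof -
    have "{u. x + u \<in> {0..1} \<and> \<bar>u\<bar> \<le> \<theta>} = {u. x + u \<in> {0..1} \<and> \<bar>u\<bar> \<le> 1}"
      using that assms by auto
    then show ?thesis by (simp add: modulus_at_def)
  qed
  then have "(modulus_at g x \<longlongrightarrow> modulus_at g x 1) at_top"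
    by (intro tendsto_eventually eventually_mono[OF eventually_ge_at_top[of 1]])
  then show ?thesis unfolding modulus_at_ext_def by (simp add: tendsto_Lim)
qed

text \<open>A pointwise form of Markov's inequality for \<open>exp T\<close>, with \<open>T = sqrt n * \<bar>y - x\<bar>\<close>: the levels
  \<open>log (n / k)\<close> exceed \<open>T\<close> exactly for \<open>k < n exp (-T)\<close>, so at least the fraction \<open>exp (-T)\<close> of the terms
  of the average dominates \<open>\<bar>g y - g x\<bar>\<close>.\<close>

lemma modulus_at_le_exp_average:
  assumes bd: "bounded (g ` {0..1})" and x: "0 \<le> x" "x \<le> 1" and y: "y \<in> {0..1}" and n: "1 \<le> n"
  shows "\<bar>g y - g x\<bar> \<le> exp (sqrt (real n) * \<bar>y - x\<bar>)
    * (1 / real n * (\<Sum>k = 0..<n. modulus_at_ext g x (ereal (1 / sqrt (real n)) * log_ratio n k)))"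
proof -
  define T where "T = sqrt (real n) * \<bar>y - x\<bar>"
  define h where "h = (\<lambda>k. modulus_at_ext g x (ereal (1 / sqrt (real n)) * log_ratio n k))"
  define K where "K = {k. real k < real n * exp (- T)}"
  have sn: "0 < sqrt (real n)" using n by simp
  have T: "0 \<le> T" by (simp add: T_def)
  have Kn: "K \<subseteq> {0..<n}"
  proof
    fix k assume "k \<in> K"
    then have "real k < real n * exp (- T)" by (simp add: K_def)
    also have "\<dots> \<le> real n * 1" using T by (intro mult_left_mono) auto
    finally show "k \<in> {0..<n}" by simp
  qed
  have h0: "h 0 = modulus_at g x 1"
    using sn modulus_at_ext_infinity[OF x] by (simp add: h_def log_ratio_def)
  have hk: "h k = modulus_at g x (1 / sqrt (real n) * ln (real n / real k))" if "k \<noteq> 0" for k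
    using that by (simp add: h_def log_ratio_def modulus_at_ext_def)
  have hnn: "0 \<le> h k" if "k < n" for k
    using that x by (cases "k = 0") (auto simp: h0 hk intro!: modulus_at_nonneg[OF bd])
  have hK: "\<bar>g y - g x\<bar> \<le> h k" if "k \<in> K" for k
  proof (cases "k = 0")
    case True
    then show ?thesis using modulus_at_upper[OF bd, of x "y - x" 1] x y by (auto simp: h0)
  next
    case False
    then have "real k < real n * exp (- T)" using that by (simp add: K_def)
    then have "exp T < real n / real k" using False by (simp add: exp_minus field_simps)
    then have "T < ln (real n / real k)" using n False by (subst ln_exp[symmetric], subst ln_less_cancel_iff) auto
    then have "\<bar>y - x\<bar> \<le> 1 / sqrt (real n) * ln (real n / real k)"
      using sn by (simp add: T_def field_simps)
    then show ?thesis using modulus_at_upper[OF bd, of x "y - x"] y hk[OF False] by auto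
  qed
  have fin: "finite K" using Kn finite_subset by blast
  \<comment> \<open>The initial segment \<open>K\<close> contains \<open>0\<close>, so its size is rounded up.\<close>
  have "real n * exp (- T) \<le> real (card K)"
  proof (rule ccontr)
    assume "\<not> ?thesis"
    then have "{0..card K} \<subseteq> K" by (auto simp: K_def)
    from card_mono[OF fin this] show False by simp
  qed
  then have "real n * exp (- T) * \<bar>g y - g x\<bar> \<le> (\<Sum>k\<in>K. \<bar>g y - g x\<bar>)"
    by (simp add: mult_right_mono)
  also have "\<dots> \<le> (\<Sum>k\<in>K. h k)" by (intro sum_mono hK)
  also have "\<dots> \<le> (\<Sum>k=0..<n. h k)" using Kn hnn by (intro sum_mono2) auto
  finally have "exp (- T) * \<bar>g y - g x\<bar> \<le> 1 / real n * (\<Sum>k=0..<n. h k)"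
    using n by (simp add: field_simps)
  from mult_left_mono[OF this, of "exp T"] show ?thesis
    unfolding h_def[symmetric] T_def[symmetric] by (simp add: exp_minus mult.assoc[symmetric])
qed

lemma exp_le_cubic:
  fixes z :: real
  shows "exp z \<le> 1 + z + z\<^sup>2 / 2 + \<bar>z\<bar> ^ 3 / 6 * exp \<bar>z\<bar>"
proof -
  obtain t where t: "\<bar>t\<bar> \<le> \<bar>z\<bar>" "exp z = (\<Sum>m<3. z ^ m / fact m) + exp t / fact 3 * z ^ 3"
    using Maclaurin_exp_le[of z 3] by blast
  have "exp t * z ^ 3 \<le> exp \<bar>z\<bar> * \<bar>z\<bar> ^ 3"
  proof -
    have "exp t * z ^ 3 \<le> exp t * \<bar>z\<bar> ^ 3"
      using power_abs[of z 3] abs_ge_self[of "z ^ 3"] by (intro mult_left_mono) auto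
    also have "\<dots> \<le> exp \<bar>z\<bar> * \<bar>z\<bar> ^ 3" using t(1) by (intro mult_right_mono) auto
    finally show ?thesis .
  qed
  then show ?thesis unfolding t(2) by (simp add: eval_nat_numeral mult_ac)
qed

lemma Bernstein_exp_moment:
  "(\<Sum>k\<le>n. exp (s * (real k - real n * x)) * Bernstein n k x)
     = (x * exp (s * (1 - x)) + (1 - x) * exp (- s * x)) ^ n"
proof -
  have "(x * exp (s * (1 - x)) + (1 - x) * exp (- s * x)) ^ n
    = (\<Sum>k\<le>n. real (n choose k) * (x * exp (s * (1 - x))) ^ k * ((1 - x) * exp (- s * x)) ^ (n - k))"
    by (rule binomial_ring)
  also have "\<dots> = (\<Sum>k\<le>n. exp (s * (real k - real n * x)) * Bernstein n k x)"
  proof (rule sum.cong)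
    fix k assume "k \<in> {..n}"
    then have k: "real (n - k) = real n - real k" by (simp add: of_nat_diff)
    have "exp (s * (1 - x)) ^ k * exp (- s * x) ^ (n - k) = exp (s * (real k - real n * x))"
      unfolding exp_of_nat_mult[symmetric] exp_add[symmetric] k by (simp add: algebra_simps)
    then show "real (n choose k) * (x * exp (s * (1 - x))) ^ k * ((1 - x) * exp (- s * x)) ^ (n - k)
      = exp (s * (real k - real n * x)) * Bernstein n k x"
      unfolding Bernstein_def power_mult_distrib by (simp add: mult_ac)
  qed simp
  finally show ?thesis by simp
qed

text \<open>The moment generating function of a centred Bernoulli variable. Averaging the cubic bound on \<open>exp\<close>
  produces the variance \<open>x (1 - x)\<close> and the third absolute moment \<open>x (1 - x) (x\<^sup>2 + (1 - x)\<^sup>2)\<close>; this is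
  where the factor \<open>x\<^sup>2 + (1 - x)\<^sup>2\<close> in the exponent comes from.\<close>

lemma Bernoulli_exp_moment_le:
  fixes x s r :: real
  assumes x: "0 \<le> x" "x \<le> 1" and s: "\<bar>s\<bar> = r"
  shows "x * exp (s * (1 - x)) + (1 - x) * exp (- s * x)
    \<le> exp (x * (1 - x) / 2 * r\<^sup>2 * (1 + (x\<^sup>2 + (1 - x)\<^sup>2) * r / 3 * exp r))"
proof -
  have r: "0 \<le> r" "s\<^sup>2 = r\<^sup>2" using s by auto
  have E: "exp (s * z) \<le> 1 + s * z + r\<^sup>2 * z\<^sup>2 / 2 + r ^ 3 * \<bar>z\<bar> ^ 3 / 6 * exp r"
    if "\<bar>z\<bar> \<le> 1" for z
  proof -
    have "\<bar>s * z\<bar> \<le> r" using that r s by (simp add: abs_mult mult_left_le)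
    then have "\<bar>s * z\<bar> ^ 3 / 6 * exp \<bar>s * z\<bar> \<le> \<bar>s * z\<bar> ^ 3 / 6 * exp r"
      by (intro mult_left_mono) auto
    then show ?thesis using exp_le_cubic[of "s * z"] r s
      by (simp add: power_mult_distrib abs_mult)
  qed
  have "x * exp (s * (1 - x)) + (1 - x) * exp (s * (- x))
      \<le> x * (1 + s * (1 - x) + r\<^sup>2 * (1 - x)\<^sup>2 / 2 + r ^ 3 * \<bar>1 - x\<bar> ^ 3 / 6 * exp r)
        + (1 - x) * (1 + s * (- x) + r\<^sup>2 * (- x)\<^sup>2 / 2 + r ^ 3 * \<bar>- x\<bar> ^ 3 / 6 * exp r)"
    using x by (intro add_mono mult_left_mono E) auto
  also have "\<dots> = 1 + x * (1 - x) / 2 * r\<^sup>2 * (1 + (x\<^sup>2 + (1 - x)\<^sup>2) * r / 3 * exp r)"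
    using x by (simp add: field_simps power2_eq_square power3_eq_cube)
  also have "\<dots> \<le> exp (x * (1 - x) / 2 * r\<^sup>2 * (1 + (x\<^sup>2 + (1 - x)\<^sup>2) * r / 3 * exp r))"
    by (rule exp_ge_add_one_self)
  finally show ?thesis by simp
qed

text \<open>The factor \<open>2\<close> comes from \<open>exp \<bar>z\<bar> \<le> exp z + exp (- z)\<close>, after which each half is a power of a Bernoulli
  moment generating function at \<open>\<plusminus> 1 / sqrt n\<close>.\<close>

lemma Bernstein_exp_abs_moment_le:
  assumes x: "0 \<le> x" "x \<le> 1" and n: "1 \<le> n"
  shows "(\<Sum>k\<le>n. exp (sqrt (real n) * \<bar>real k / real n - x\<bar>) * Bernstein n k x)
    \<le> 2 * exp (x * (1 - x) / 2
        * (1 + (x\<^sup>2 + (1 - x)\<^sup>2) / (3 * sqrt (real n)) * exp (1 / sqrt (real n))))"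
proof -
  define r where "r = 1 / sqrt (real n)"
  define M where "M = exp (x * (1 - x) / 2 * (1 + (x\<^sup>2 + (1 - x)\<^sup>2) * r / 3 * exp r))"
  have r: "0 < r" "real n * r\<^sup>2 = 1" using n by (simp_all add: r_def power_divide)
  have one: "(\<Sum>k\<le>n. exp (s * (real k - real n * x)) * Bernstein n k x) \<le> M" if "\<bar>s\<bar> = r" for s
  proof -
    have "(\<Sum>k\<le>n. exp (s * (real k - real n * x)) * Bernstein n k x)
      \<le> exp (x * (1 - x) / 2 * r\<^sup>2 * (1 + (x\<^sup>2 + (1 - x)\<^sup>2) * r / 3 * exp r)) ^ n"
      unfolding Bernstein_exp_moment using x that
      by (intro power_mono Bernoulli_exp_moment_le) auto
    also have "\<dots> = exp (x * (1 - x) / 2 * (real n * r\<^sup>2) * (1 + (x\<^sup>2 + (1 - x)\<^sup>2) * r / 3 * exp r))"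
      unfolding exp_of_nat_mult[symmetric] by (simp add: mult_ac)
    finally show ?thesis by (simp add: r(2) M_def)
  qed
  have "(\<Sum>k\<le>n. exp (sqrt (real n) * \<bar>real k / real n - x\<bar>) * Bernstein n k x)
    \<le> (\<Sum>k\<le>n. (exp (r * (real k - real n * x)) + exp (- r * (real k - real n * x))) * Bernstein n k x)"
  proof (intro sum_mono mult_right_mono Bernstein_nonneg x)
    fix k
    have "sqrt (real n) * (real k / real n - x) = r * (real k - real n * x)"
    proof -
      have "sqrt (real n) = r * real n" using n by (simp add: r_def real_div_sqrt)
      then show ?thesis using n by (simp add: algebra_simps)
    qed
    then have "sqrt (real n) * \<bar>real k / real n - x\<bar> = \<bar>r * (real k - real n * x)\<bar>"
      by (metis abs_mult abs_of_nonneg real_sqrt_ge_zero of_nat_0_le_iff)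
    moreover have "exp \<bar>z\<bar> \<le> exp z + exp (- z)" for z :: real by (simp add: abs_if)
    ultimately show "exp (sqrt (real n) * \<bar>real k / real n - x\<bar>)
        \<le> exp (r * (real k - real n * x)) + exp (- r * (real k - real n * x))"
      by simp
  qed
  also have "\<dots> = (\<Sum>k\<le>n. exp (r * (real k - real n * x)) * Bernstein n k x)
      + (\<Sum>k\<le>n. exp (- r * (real k - real n * x)) * Bernstein n k x)"
    by (simp add: distrib_right sum.distrib)
  also have "\<dots> \<le> M + M" using r by (intro add_mono one) auto
  also have "M = exp (x * (1 - x) / 2
        * (1 + (x\<^sup>2 + (1 - x)\<^sup>2) / (3 * sqrt (real n)) * exp (1 / sqrt (real n))))"
    unfolding M_def r_def by (simp add: mult.commute)
  finally show ?thesis by simp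
qed

lemma bernstein_op_modulus_bound:
  assumes bd: "bounded (g ` {0..1})" and g: "g x = 0" and x: "0 \<le> x" "x \<le> 1" and n: "1 \<le> n"
  shows "\<bar>bernstein_op n g x\<bar> \<le> 2 * exp (x * (1 - x) / 2
        * (1 + (x\<^sup>2 + (1 - x)\<^sup>2) / (3 * sqrt (real n)) * exp (1 / sqrt (real n))))
      * (1 / real n * (\<Sum>k = 0..<n. modulus_at_ext g x (ereal (1 / sqrt (real n)) * log_ratio n k)))"
    (is "_ \<le> ?M * ?W")
proof -
  have W: "0 \<le> exp (sqrt (real n) * \<bar>x - x\<bar>) * ?W"
    by (rule order_trans[OF abs_ge_zero modulus_at_le_exp_average[OF bd x _ n]]) (use x in auto)
  have "\<bar>bernstein_op n g x\<bar> \<le> (\<Sum>k\<le>n. \<bar>g (real k / real n)\<bar> * Bernstein n k x)"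
    unfolding bernstein_op_def using x
    by (intro order_trans[OF sum_abs] sum_mono) (auto simp: abs_mult Bernstein_nonneg)
  also have "\<dots> \<le> (\<Sum>k\<le>n. exp (sqrt (real n) * \<bar>real k / real n - x\<bar>) * ?W * Bernstein n k x)"
  proof (intro sum_mono mult_right_mono Bernstein_nonneg x)
    fix k assume "k \<in> {..n}"
    then have "real k / real n \<in> {0..1}" using n by auto
    from modulus_at_le_exp_average[OF bd x this n]
    show "\<bar>g (real k / real n)\<bar> \<le> exp (sqrt (real n) * \<bar>real k / real n - x\<bar>) * ?W"
      by (simp add: g)
  qed
  also have "\<dots> = (\<Sum>k\<le>n. exp (sqrt (real n) * \<bar>real k / real n - x\<bar>) * Bernstein n k x) * ?W"
    unfolding sum_distrib_right by (intro sum.cong refl) (simp only: mult_ac)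
  also have "\<dots> \<le> ?M * ?W"
    using W by (intro mult_right_mono Bernstein_exp_abs_moment_le x n) simp
  finally show ?thesis .
qed

section \<open>The local bound at an integer mean\<close>

text \<open>The logarithm of \<open>n! exp n / (sqrt n * n^n)\<close>, which tends to \<open>ln (2 pi) / 2\<close> by Stirling's formula.\<close>

definition log_stirling_ratio :: "nat \<Rightarrow> real" where
  "log_stirling_ratio n = ln (fact n) + real n - (real n + 1/2) * ln (real n)"

lemma log_stirling_ratio_Suc:
  assumes "n \<ge> 1"
  shows "log_stirling_ratio (Suc n) - log_stirling_ratio n
    = 1 - (real n + 1/2) * (ln (real (Suc n)) - ln (real n))"
proof -
  have "ln (fact (Suc n)) = ln (real (Suc n)) + ln (fact n)"
    unfolding fact_Suc of_nat_mult by (subst ln_mult) auto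
  then show ?thesis by (simp add: log_stirling_ratio_def algebra_simps)
qed

text \<open>The increments are nonpositive because the integral of \<open>1 / t\<close> over \<open>[n, n + 1]\<close> is at least its midpoint
  value.\<close>

lemma log_stirling_ratio_antimono:
  assumes "1 \<le> m" "m \<le> n"
  shows "log_stirling_ratio n \<le> log_stirling_ratio m"
  using assms(2)
proof (induction n rule: dec_induct)
  case (step n)
  have n: "real n > 0" using step assms by simp
  have "2 * (real (Suc n) - real n) / (real n + real (Suc n)) \<le> ln (real (Suc n)) - ln (real n)"
    by (rule ln_inverse_approx_ge) (use n in auto)
  from mult_left_mono[OF this, of "real n + 1/2"]
  have "1 \<le> (real n + 1/2) * (ln (real (Suc n)) - ln (real n))"
    by (simp add: field_simps)
  then show ?case using log_stirling_ratio_Suc[of n] step assms by simp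
qed simp

text \<open>The trapezoidal bound on the same integral limits each decrement by a telescoping quantity. This keeps the
  sequence bounded below, so that its limit \<open>L\<close> is finite and can be read off from Wallis' product.\<close>

lemma log_stirling_ratio_lower:
  assumes "1 \<le> n"
  shows "log_stirling_ratio 1 - 1/4 \<le> log_stirling_ratio n - 1 / (4 * real n)"
  using assms
proof (induction n rule: dec_induct)
  case (step n)
  have n: "real n > 0" using step assms by simp
  have "ln (real (Suc n)) - ln (real n) \<le> 0.5 * (1 / real n + 1 / real (Suc n)) * (real (Suc n) - real n)"
    using ln_inverse_approx_le[of "real n" "1"] n by (simp add: inverse_eq_divide add.commute)
  from mult_left_mono[OF this, of "real n + 1/2"]
  have "(real n + 1/2) * (ln (real (Suc n)) - ln (real n))
      \<le> (real n + 1/2) * (0.5 * (1 / real n + 1 / real (Suc n)) * (real (Suc n) - real n))"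
    by simp
  also have "\<dots> = 1 + 1 / (4 * real n) - 1 / (4 * real (Suc n))"
    using n by (simp add: divide_simps) (simp add: algebra_simps)
  finally have "(real n + 1/2) * (ln (real (Suc n)) - ln (real n))
      \<le> 1 + 1 / (4 * real n) - 1 / (4 * real (Suc n))" .
  then show ?case using log_stirling_ratio_Suc[of n] step assms by simp
qed simp

lemma wallis_prod_eq:
  "(\<Prod>k=1..n. (4*real k^2) / (4*real k^2 - 1)) = 16 ^ n * fact n ^ 4 / (fact (2*n) ^ 2 * (2 * real n + 1))"
proof (induction n)
  case (Suc n)
  define a b c D where "a = real n + 1" and "b = 2 * real n + 1" and "c = 2 * real n + 3"
    and "D = (fact (2*n) :: real)"
  have pos: "a > 0" "b > 0" "c > 0" "D > 0" by (simp_all add: a_def b_def c_def D_def)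
  have e1: "4*real (Suc n)^2 - 1 = b * c" "real (Suc n) = a" "2 * real (Suc n) + 1 = c"
    by (simp_all add: power2_eq_square algebra_simps a_def b_def c_def)
  have e2: "fact (2 * Suc n) = 2 * a * b * D"
    by (simp add: algebra_simps a_def b_def D_def)
  have e3: "fact (Suc n) = a * fact n" by (simp add: algebra_simps a_def)
  have "(\<Prod>k=1..Suc n. (4*real k^2) / (4*real k^2 - 1))
      = 16 ^ n * fact n ^ 4 / (D\<^sup>2 * b) * (4 * a\<^sup>2 / (b * c))"
    using Suc e1 by (simp add: b_def D_def del: of_nat_Suc)
  also have "\<dots> = 16 ^ Suc n * (a * fact n) ^ 4 / ((2 * a * b * D)\<^sup>2 * c)"
    using pos by (simp add: divide_simps power_mult_distrib power2_eq_square eval_nat_numeral)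
  finally show ?case unfolding e2 e3 e1(3) .
qed simp

text \<open>Everything cancels in this combination except a partial Wallis product and a factor tending to \<open>4\<close>. Letting
  \<open>n\<close> tend to infinity determines the limit \<open>L\<close> of the logarithms, as \<open>4 L - 2 L = ln (2 pi)\<close>.\<close>

lemma stirling_wallis:
  assumes "n \<ge> 1"
  shows "4 * log_stirling_ratio n - 2 * log_stirling_ratio (2*n)
    = ln ((\<Prod>k=1..n. (4*real k^2) / (4*real k^2 - 1)) * (4 + 2 / real n))"
proof -
  have n: "real n > 0" using assms by simp
  have f: "(0::real) < fact k" for k by simp
  have "(\<Prod>k=1..n. (4*real k^2) / (4*real k^2 - 1)) * (4 + 2 / real n)
     = 16 ^ n * fact n ^ 4 * 2 / (fact (2*n) ^ 2 * real n)"
  proof -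
    define b where "b = 2 * real n + 1"
    have "b > 0" by (simp add: b_def)
    moreover have "4 + 2 / real n = 2 * b / real n" using n by (simp add: field_simps b_def)
    ultimately show ?thesis unfolding wallis_prod_eq b_def[symmetric] by simp
  qed
  also have "ln \<dots> = real n * ln 16 + 4 * ln (fact n) + ln 2 - 2 * ln (fact (2*n)) - ln (real n)"
    using n by (simp add: ln_div ln_mult ln_realpow)
  also have "ln (16::real) = 4 * ln 2" using ln_realpow[of "2::real" 4] by simp
  finally show ?thesis unfolding log_stirling_ratio_def
    using n by (simp add: ln_mult algebra_simps)
qed

lemma log_stirling_ratio_ge:
  assumes "n \<ge> 1"
  shows "ln (2 * pi) / 2 \<le> log_stirling_ratio n"
proof -
  define r where "r = (\<lambda>n. log_stirling_ratio (Suc n))"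
  have "decseq r" unfolding decseq_def r_def using log_stirling_ratio_antimono by simp
  moreover have "log_stirling_ratio 1 - 1/4 \<le> r i" for i
  proof -
    have "0 \<le> 1 / (4 * real (Suc i))" by simp
    then show ?thesis unfolding r_def using log_stirling_ratio_lower[of "Suc i"] by linarith
  qed
  ultimately obtain L where "r \<longlonglongrightarrow> L" and Lle: "\<And>i. L \<le> r i"
    using decseq_convergent[of r "log_stirling_ratio 1 - 1/4"] by blast
  then have L: "log_stirling_ratio \<longlonglongrightarrow> L" unfolding r_def by (rule_tac LIMSEQ_imp_Suc)
  have "strict_mono (\<lambda>n::nat. 2 * n)" by (simp add: strict_mono_def)
  from LIMSEQ_subseq_LIMSEQ[OF L this]
  have L2: "(\<lambda>n. log_stirling_ratio (2*n)) \<longlonglongrightarrow> L" by (simp add: o_def)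
  have "(\<lambda>n. 4 * log_stirling_ratio n - 2 * log_stirling_ratio (2*n)) \<longlonglongrightarrow> 4 * L - 2 * L"
    by (intro tendsto_intros L L2)
  moreover have "(\<lambda>n. ln ((\<Prod>k=1..n. (4*real k^2) / (4*real k^2 - 1)) * (4 + 2 / real n)))
      \<longlonglongrightarrow> ln (pi / 2 * (4 + 0))"
    by (intro tendsto_intros wallis lim_const_over_n) auto
  then have "(\<lambda>n. 4 * log_stirling_ratio n - 2 * log_stirling_ratio (2*n)) \<longlonglongrightarrow> ln (2 * pi)"
    using stirling_wallis
    by (auto elim!: Lim_transform_eventually intro!: eventually_sequentiallyI[of 1] simp: mult.commute)
  ultimately have "4 * L - 2 * L = ln (2 * pi)" by (rule LIMSEQ_unique)
  moreover have "L \<le> log_stirling_ratio n" using Lle[of "n - 1"] assms by (simp add: r_def)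
  ultimately show ?thesis by linarith
qed

text \<open>At its mean \<open>m = n p\<close> the binomial probability is the Stirling ratio of \<open>n\<close> divided by those of \<open>m\<close> and
  \<open>n - m\<close>, times \<open>sqrt (n / (m (n - m)))\<close>. The ratio of \<open>n\<close> is at most that of \<open>m\<close>, and the ratio of
  \<open>n - m\<close> is at least \<open>sqrt (2 pi)\<close>.\<close>

lemma Bernstein_integer_mean_le:
  fixes p :: real
  assumes "0 < m" "m < n" and p: "p = real m / real n"
  shows "Bernstein n m p \<le> 1 / sqrt (2 * pi * real n * p * (1 - p))"
proof -
  define l where "l = n - m"
  have l: "l > 0" "n = m + l" using assms by (auto simp: l_def)
  have q: "1 - p = real l / real n" using l p by (simp add: field_simps)
  have pos: "0 < p" "0 < 1 - p" unfolding q using p assms l by auto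
  have np: "2 * pi * real n * p * (1 - p) = 2 * pi * (real m * real l / real n)"
    unfolding q unfolding p using assms by simp
  have "ln (Bernstein n m p) = ln (fact n) - ln (fact m) - ln (fact l)
      + real m * (ln (real m) - ln (real n)) + real l * (ln (real l) - ln (real n))"
    unfolding Bernstein_def using l q p assms(1) pos
    by (simp add: binomial_fact ln_mult ln_div ln_realpow)
  also have "\<dots> = log_stirling_ratio n - log_stirling_ratio m - log_stirling_ratio l
      - 1/2 * (ln (real m) + ln (real l) - ln (real n))"
    using l by (simp add: log_stirling_ratio_def algebra_simps)
  also have "\<dots> \<le> - ln (2 * pi) / 2 - 1/2 * (ln (real m) + ln (real l) - ln (real n))"
    using log_stirling_ratio_antimono[of m n] log_stirling_ratio_ge[of l] assms l by simp
  also have "\<dots> = ln (1 / sqrt (2 * pi * real n * p * (1 - p)))"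
    unfolding np using assms l by (simp add: ln_div ln_sqrt ln_mult field_simps del: of_nat_add)
  finally show ?thesis
    using pos assms Bernstein_pos[of p m n] by (subst (asm) ln_le_cancel_iff) auto
qed

section \<open>The binomial distribution function as a function of the parameter\<close>

definition bin_cdf :: "nat \<Rightarrow> nat \<Rightarrow> real \<Rightarrow> real" where
  "bin_cdf n k t = (\<Sum>j\<le>k. Bernstein n j t)"

lemma has_real_derivative_Bernstein:
  assumes "k < n"
  shows "(Bernstein n (Suc k) has_real_derivative
      real (n choose Suc k) * (real (Suc k) * t ^ k * (1 - t) ^ (n - Suc k)
        - real (n - Suc k) * t ^ Suc k * (1 - t) ^ (n - Suc k - 1))) (at t)"
  unfolding Bernstein_def [abs_def]
  by (rule derivative_eq_intros refl | simp)+ (simp add: algebra_simps)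

text \<open>The derivatives of neighbouring terms of the sum cancel, so only the top term leaves a trace.\<close>

lemma has_real_derivative_bin_cdf:
  assumes "k \<le> n"
  shows "(bin_cdf n k has_real_derivative
      - (real (n - k) * real (n choose k) * t ^ k * (1 - t) ^ (n - k - 1))) (at t)"
  using assms
proof (induction k)
  case 0
  show ?case unfolding bin_cdf_def [abs_def] Bernstein_def
    by (rule derivative_eq_intros refl | simp)+
next
  case (Suc k)
  have F: "bin_cdf n (Suc k) = (\<lambda>t. bin_cdf n k t + Bernstein n (Suc k) t)"
    by (simp add: bin_cdf_def fun_eq_iff)
  have "real (Suc k) * real (n choose Suc k) = real (n - k) * real (n choose k)"
    using binomial_absorb_comp[of n k] binomial_absorption[of k n] Suc.prems
    by (metis of_nat_mult)
  then have eq: "real (n choose Suc k) * (real (Suc k) * t ^ k * (1 - t) ^ (n - Suc k))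
      = real (n - k) * real (n choose k) * t ^ k * (1 - t) ^ (n - k - 1)"
    by (simp add: mult.assoc[symmetric] mult.commute[of "real (n choose Suc k)"])
  show ?case unfolding F
  proof (rule DERIV_cong[OF DERIV_add[OF Suc.IH has_real_derivative_Bernstein]])
    show "- (real (n - k) * real (n choose k) * t ^ k * (1 - t) ^ (n - k - 1))
        + real (n choose Suc k) * (real (Suc k) * t ^ k * (1 - t) ^ (n - Suc k)
          - real (n - Suc k) * t ^ Suc k * (1 - t) ^ (n - Suc k - 1))
      = - (real (n - Suc k) * real (n choose Suc k) * t ^ Suc k * (1 - t) ^ (n - Suc k - 1))"
      unfolding right_diff_distrib eq by (simp add: mult_ac)
  qed (use Suc.prems in auto)
qed

lemma bin_cdf_1: "k < n \<Longrightarrow> bin_cdf n k 1 = 0"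
  unfolding bin_cdf_def Bernstein_def by (intro sum.neutral) auto

lemma bin_cdf_antimono:
  assumes "0 \<le> s" "s \<le> t" "t \<le> 1" "k \<le> n"
  shows "bin_cdf n k t \<le> bin_cdf n k s"
  using assms has_real_derivative_bin_cdf[OF assms(4)]
  by (intro DERIV_nonpos_imp_nonincreasing[of s t "bin_cdf n k"]) fastforce+

lemma Bernstein_symmetric: "k \<le> n \<Longrightarrow> Bernstein n (n - k) (1 - t) = Bernstein n k t"
  by (simp add: Bernstein_def binomial_symmetric[of k n])

text \<open>Exchanging successes and failures turns upper tails into lower tails. All upper tails below are written in
  this way.\<close>

lemma bin_cdf_symmetric:
  assumes "k < n"
  shows "bin_cdf n k t = 1 - bin_cdf n (n - Suc k) (1 - t)"
proof -
  have "(\<Sum>j\<le>n. Bernstein n j t) = (\<Sum>j\<le>k. Bernstein n j t) + (\<Sum>j\<in>{k<..n}. Bernstein n j t)"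
    using assms by (subst sum.union_disjoint[symmetric]) (auto intro!: sum.cong arg_cong[of _ _ "sum _"] simp del: sum_Bernstein)
  moreover have "(\<Sum>j\<in>{k<..n}. Bernstein n j t) = (\<Sum>j\<le>n - Suc k. Bernstein n j (1 - t))"
    using assms
    by (intro sum.reindex_bij_witness[of _ "\<lambda>j. n - j" "\<lambda>j. n - j"])
      (auto simp: Bernstein_symmetric)
  ultimately show ?thesis unfolding bin_cdf_def by simp
qed

lemma bin_cdf_half_ge:
  assumes "n \<le> 2 * k + 1" "k < n"
  shows "1 / 2 \<le> bin_cdf n k (1 / 2)"
proof -
  have "bin_cdf n (n - Suc k) (1 / 2) \<le> bin_cdf n k (1 / 2)"
    unfolding bin_cdf_def using assms by (intro sum_mono2) (auto intro: Bernstein_nonneg)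
  then show ?thesis using bin_cdf_symmetric[OF assms(2), of "1/2"] by simp
qed

lemma has_real_derivative_Bernstein_log:
  assumes "0 < m" "m < n" "0 < t" "t < 1"
  shows "(Bernstein n m has_real_derivative
      Bernstein n m t * (real m - real n * t) / (t * (1 - t))) (at t)"
proof -
  obtain k where m: "m = Suc k" using assms(1) by (cases m) auto
  obtain j where n: "n = Suc (m + j)" using assms(2) less_iff_Suc_add by blast
  show ?thesis unfolding n m
    by (rule DERIV_cong, rule has_real_derivative_Bernstein)
      (use assms(3,4) in \<open>simp_all add: Bernstein_def divide_simps\<close>, simp add: algebra_simps)
qed

lemma has_real_derivative_bin_cdf_Bernstein:
  assumes "m < n" "t < 1"
  shows "(bin_cdf n m has_real_derivative - (real (n - m) * Bernstein n m t / (1 - t))) (at t)"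
proof -
  obtain j where n: "n = Suc (m + j)" using assms(1) less_iff_Suc_add by blast
  show ?thesis unfolding n
    by (rule DERIV_cong, rule has_real_derivative_bin_cdf)
      (use assms(2) in \<open>simp_all add: Bernstein_def divide_simps\<close>)
qed

section \<open>Comparing the two tails at an integer mean\<close>

text \<open>Let \<open>p = m / n\<close>. The weight \<open>q + p q / u\<close> is chosen so that its product with the derivative of
  \<open>Bernstein n m (p + u)\<close> is the derivative of the distribution function. In the derivative of the difference
  only \<open>p q * Bernstein n m (p + u) / u\<^sup>2\<close> is left. The left tail is the same object with
  \<open>n - m\<close> in place of \<open>m\<close>, which exchanges \<open>p\<close> and \<open>q\<close> and thus keeps the factor \<open>p q\<close>.\<close>

definition tail_excess :: "nat \<Rightarrow> nat \<Rightarrow> real \<Rightarrow> real" where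
  "tail_excess n m u = (let p = real m / real n; q = 1 - p in
     bin_cdf n m (p + u) - (q + p * q / u) * Bernstein n m (p + u))"

lemma has_real_derivative_tail_excess:
  assumes "0 < m" "m < n" and p: "p = real m / real n" and q: "q = 1 - p" and u: "0 < u" "u < q"
  shows "(tail_excess n m has_real_derivative p * q * Bernstein n m (p + u) / u\<^sup>2) (at u)"
proof -
  have n: "real m = real n * p" "real (n - m) = real n * q" "p > 0"
    unfolding q p using assms(1,2) by (simp_all add: field_simps)
  have t: "0 < p + u" "p + u < 1" using u n q by auto
  have t2: "1 - (p + u) = q - u" using q by simp
  have B: "((\<lambda>u. Bernstein n m (p + u)) has_real_derivative
      - (Bernstein n m (p + u) * (real n * u) / ((p + u) * (q - u)))) (at u)"
    by (rule DERIV_cong[OF DERIV_chain2[where g = "\<lambda>u. p + u", OF has_real_derivative_Bernstein_log[OF assms(1,2) t]]])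
      (rule derivative_eq_intros refl | simp add: n t2 algebra_simps)+
  have F: "((\<lambda>u. bin_cdf n m (p + u)) has_real_derivative
      - (real n * q * Bernstein n m (p + u) / (q - u))) (at u)"
    by (rule DERIV_cong[OF DERIV_chain2[where g = "\<lambda>u. p + u", OF has_real_derivative_bin_cdf_Bernstein[OF assms(2) t(2)]]])
      (rule derivative_eq_intros refl | simp add: n t2 del: of_nat_diff)+
  have eq: "tail_excess n m = (\<lambda>u. bin_cdf n m (p + u) - (q + p * q / u) * Bernstein n m (p + u))"
    by (simp add: tail_excess_def Let_def p q fun_eq_iff)
  have "q + p * q / u = q * (p + u) / u" using u by (simp add: field_simps)
  then have key: "(q + p * q / u) * (Bernstein n m (p + u) * (real n * u) / ((p + u) * (q - u)))
      = real n * q * Bernstein n m (p + u) / (q - u)"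
    using u t by simp
  have W: "((\<lambda>u. q + p * q / u) has_real_derivative - (p * q / u\<^sup>2)) (at u)"
    using u by (auto intro!: derivative_eq_intros simp: power2_eq_square)
  show ?thesis unfolding eq
    by (rule DERIV_cong[OF DERIV_diff[OF F DERIV_mult[OF W B]]]) (use key in \<open>simp add: mult.commute\<close>)
qed

lemma tail_excess_end:
  assumes "0 < m" "m < n"
  shows "tail_excess n m (1 - real m / real n) = 0"
  using assms by (simp add: tail_excess_def bin_cdf_1 Bernstein_def Let_def)

lemma continuous_on_Bernstein: "continuous_on S (\<lambda>t. Bernstein n k t)"
  unfolding Bernstein_def by (intro continuous_intros)

lemma continuous_on_bin_cdf: "continuous_on S (\<lambda>t. bin_cdf n k t)"
  unfolding bin_cdf_def by (intro continuous_intros continuous_on_Bernstein)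

lemma continuous_on_tail_excess:
  assumes "0 \<notin> S"
  shows "continuous_on S (tail_excess n m)"
proof -
  define p where "p = real m / real n"
  show ?thesis
    unfolding tail_excess_def [abs_def] Let_def p_def[symmetric] using assms
    by (auto intro!: continuous_intros continuous_on_compose2[OF continuous_on_Bernstein]
        continuous_on_compose2[OF continuous_on_bin_cdf])
qed

lemma Bernstein_eq_exp:
  assumes "m \<le> n" "0 < t" "t < 1"
  shows "Bernstein n m t = real (n choose m) * exp (real m * ln t + real (n - m) * ln (1 - t))"
  using assms by (simp add: Bernstein_def exp_add exp_of_nat_mult del: of_nat_diff)

text \<open>The logarithm of \<open>t^m (1 - t)^(n - m)\<close>, recentred at its maximum \<open>p\<close>.\<close>

lemma has_real_derivative_log_shape:
  fixes p :: real
  assumes "m \<le> n" and m: "real m = real n * p" and q: "q = 1 - p" and u: "0 < p + u" "u < q"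
  shows "((\<lambda>u. real m * ln (p + u) + real (n - m) * ln (1 - (p + u))) has_real_derivative
      - (real n * u / ((p + u) * (q - u)))) (at u)"
proof -
  have n: "real (n - m) = real n * q" unfolding of_nat_diff[OF assms(1)] m by (simp add: q algebra_simps)
  have pos: "1 - (p + u) = q - u" "0 < q - u" using u q by auto
  have "real n * p / (p + u) - real n * q / (q - u) = - (real n * u / ((p + u) * (q - u)))"
    using pos(2) u(1) by (simp add: divide_simps) (simp add: q algebra_simps)
  moreover have "((\<lambda>u. ln (p + u)) has_real_derivative 1 / (p + u)) (at u)"
    using u(1) by (auto intro!: derivative_eq_intros)
  moreover have "((\<lambda>u. ln (1 - (p + u))) has_real_derivative - 1 / (q - u)) (at u)"
    unfolding pos(1)[symmetric] using pos by (auto intro!: derivative_eq_intros)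
  ultimately show ?thesis
    unfolding m n by (auto intro!: DERIV_cong[OF DERIV_add[OF DERIV_cmult DERIV_cmult]])
qed

text \<open>The map \<open>u \<mapsto> u / (1 + c u)\<close> pairs a point to the right of the maximum \<open>p\<close> with one to the left. Comparing the
  logarithmic derivatives of the two branches along this pairing reduces the comparison of their heights to
  one inequality between polynomials in \<open>v\<close>.\<close>

lemma Bernstein_mean_shift_bounds:
  fixes p q c u :: real
  assumes "0 < m" "m < n" and p: "p = real m / real n" and q: "q = 1 - p"
    and u: "0 < u" "u < q" and c: "0 \<le> c" and left: "u < p * (1 + c * u)"
  shows "(\<And>v. 0 < v \<Longrightarrow> v < u \<Longrightarrow> (p + v) * (q - v) \<le> (1 + c * v) * (p * (1+c * v) - v) * (q * (1+c * v) + v))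
      \<Longrightarrow> Bernstein n m (p + u) \<le> Bernstein n m (p - u / (1 + c * u))"
    and "(\<And>v. 0 < v \<Longrightarrow> v < u \<Longrightarrow> (1 + c * v) * (p * (1+c * v) - v) * (q * (1+c * v) + v) \<le> (p + v) * (q - v))
      \<Longrightarrow> Bernstein n m (p - u / (1 + c * u)) \<le> Bernstein n m (p + u)"
proof -
  have n: "real m = real n * p" "p > 0" "real n > 0"
    unfolding p using assms(1,2) by (simp_all add: field_simps)
  define L where "L = (\<lambda>u. real m * ln (p + u) + real (n - m) * ln (1 - (p + u)))"
  define g where "g = (\<lambda>v. L v - L (- (v / (1 + c * v))))"
  have wpos: "0 < 1 + c * v" if "0 \<le> v" for v using that c by (simp add: add_pos_nonneg)
  have left': "v < p * (1 + c * v)" if "0 \<le> v" "v \<le> u" for v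
  proof -
    have "v * (1 - p * c) \<le> max 0 (u * (1 - p * c))"
      using that u by (cases "0 \<le> 1 - p * c") (auto intro: mult_right_mono simp: mult_nonneg_nonpos max_def zero_le_mult_iff)
    moreover have "u * (1 - p * c) < p" using left by (simp add: algebra_simps)
    ultimately have "v * (1 - p * c) < p" using n by (simp add: max_def split: if_splits)
    then show ?thesis by (simp add: algebra_simps)
  qed
  have tau: "v / (1 + c * v) < p" if "0 \<le> v" "v \<le> u" for v
    using left'[OF that] wpos[OF that(1)] by (simp add: divide_simps)
  have D: "(g has_real_derivative real n * v *
      (1 / ((1 + c * v) * (p * (1+c * v) - v) * (q * (1+c * v) + v)) - 1 / ((p + v) * (q - v)))) (at v)"
    if v: "0 \<le> v" "v \<le> u" for v
  proof -
    define w t where "w = 1 + c * v" and "t = v / w"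
    have w: "0 < w" unfolding w_def using wpos v by auto
    have t: "0 \<le> t" "t < p" using tau[OF v] v w by (auto simp: t_def w_def)
    have qpos: "0 < q" using u by simp
    have D1: "(L has_real_derivative - (real n * v / ((p + v) * (q - v)))) (at v)"
      unfolding L_def using v u n q assms(2) by (intro has_real_derivative_log_shape) auto
    have D2: "(L has_real_derivative - (real n * (- t) / ((p + (- t)) * (q - (- t))))) (at (- t))"
      unfolding L_def using t u n q assms(2) by (intro has_real_derivative_log_shape) auto
    have D3: "((\<lambda>v. - (v / (1 + c * v))) has_real_derivative - (1 / w\<^sup>2)) (at v)"
    proof -
      have "1 + c * v \<noteq> 0" using w by (simp add: w_def)
      then have "((\<lambda>v. - (v / (1 + c * v))) has_real_derivative
          - ((1 * (1 + c * v) - v * c) / ((1 + c * v) * (1 + c * v)))) (at v)"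
        by (intro DERIV_minus DERIV_divide DERIV_ident) (auto intro!: derivative_eq_intros)
      then show ?thesis by (rule DERIV_cong) (simp add: w_def power2_eq_square mult.commute)
    qed
    have "((\<lambda>v. L (- (v / (1 + c * v)))) has_real_derivative
        - (real n * (- t) / ((p + (- t)) * (q - (- t)))) * - (1 / w\<^sup>2)) (at v)"
      by (rule DERIV_chain2[OF _ D3]) (use D2 in \<open>simp add: t_def w_def\<close>)
    from DERIV_diff[OF D1 this] show ?thesis
      unfolding g_def
    proof (rule DERIV_cong)
      have e: "p - t = (p * w - v) / w" "q + t = (q * w + v) / w" "0 < p * w - v" "0 < q * w + v"
        using w left'[OF v] v qpos
        by (simp_all add: t_def diff_divide_distrib add_divide_distrib w_def[symmetric] add_pos_nonneg)
      have "real n * t / ((p - t) * (q + t)) / w\<^sup>2 = real n * v / (w * (p * w - v) * (q * w + v))"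
        unfolding e t_def using w e(3,4) by (simp add: divide_simps power2_eq_square)
      then show "- (real n * v / ((p + v) * (q - v)))
          - - (real n * - t / ((p + - t) * (q - - t))) * - (1 / w\<^sup>2)
        = real n * v * (1 / ((1 + c * v) * (p * (1+c * v) - v) * (q * (1+c * v) + v)) - 1 / ((p + v) * (q - v)))"
        unfolding w_def[symmetric] by (simp add: right_diff_distrib)
    qed
  qed
  have cont: "continuous_on {0..u} g"
    by (rule DERIV_atLeastAtMost_imp_continuous_on) (use D in blast)
  have g0: "g 0 = 0" by (simp add: g_def)
  have pos: "0 < (1 + c * v) * (p * (1+c * v) - v) * (q * (1+c * v) + v)" "0 < (p + v) * (q - v)"
    if "0 < v" "v < u" for v
    using wpos[of v] left'[of v] that u n by (auto intro!: mult_pos_pos add_pos_pos)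
  have B: "Bernstein n m (p + u) = real (n choose m) * exp (L u)"
    "Bernstein n m (p - u / (1 + c * u)) = real (n choose m) * exp (L (- (u / (1 + c * u))))"
  proof -
    have "0 \<le> u / (1 + c * u)" "u / (1 + c * u) < p" using tau[of u] u wpos[of u] by auto
    then show "Bernstein n m (p - u / (1 + c * u)) = real (n choose m) * exp (L (- (u / (1 + c * u))))"
      unfolding L_def using u q assms(2) by (subst Bernstein_eq_exp) (auto simp del: of_nat_diff)
    show "Bernstein n m (p + u) = real (n choose m) * exp (L u)"
      unfolding L_def using u q n assms(2) by (subst Bernstein_eq_exp) (auto simp del: of_nat_diff)
  qed
  {
    assume *: "\<And>v. 0 < v \<Longrightarrow> v < u \<Longrightarrow> (p + v) * (q - v) \<le> (1 + c * v) * (p * (1+c * v) - v) * (q * (1+c * v) + v)"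
    have "g u \<le> g 0"
    proof (rule DERIV_nonpos_imp_decreasing_open[OF _ _ cont])
      fix v assume v: "0 < v" "v < u"
      have "1 / ((1 + c * v) * (p * (1+c * v) - v) * (q * (1+c * v) + v)) \<le> 1 / ((p + v) * (q - v))"
        by (rule divide_left_mono[OF *[OF v] zero_le_one mult_pos_pos[OF pos(1)[OF v] pos(2)[OF v]]])
      then have "real n * v * (1 / ((1 + c * v) * (p * (1 + c * v) - v) * (q * (1 + c * v) + v)) - 1 / ((p + v) * (q - v))) \<le> 0"
        using v by (intro mult_nonneg_nonpos) auto
      then show "\<exists>y. (g has_real_derivative y) (at v) \<and> y \<le> 0"
        using D[of v] v less_imp_le by blast
    qed (use u in auto)
    then show "Bernstein n m (p + u) \<le> Bernstein n m (p - u / (1 + c * u))"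
      unfolding B g0 by (intro mult_left_mono) (auto simp: g_def)
  }
  {
    assume *: "\<And>v. 0 < v \<Longrightarrow> v < u \<Longrightarrow> (1 + c * v) * (p * (1+c * v) - v) * (q * (1+c * v) + v) \<le> (p + v) * (q - v)"
    have "g 0 \<le> g u"
    proof (rule DERIV_nonneg_imp_increasing_open[OF _ _ cont])
      fix v assume v: "0 < v" "v < u"
      have "1 / ((p + v) * (q - v)) \<le> 1 / ((1 + c * v) * (p * (1+c * v) - v) * (q * (1+c * v) + v))"
        by (rule divide_left_mono[OF *[OF v] zero_le_one mult_pos_pos[OF pos(2)[OF v] pos(1)[OF v]]])
      then have "0 \<le> real n * v * (1 / ((1 + c * v) * (p * (1 + c * v) - v) * (q * (1 + c * v) + v)) - 1 / ((p + v) * (q - v)))"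
        using v by (intro mult_nonneg_nonneg) auto
      then show "\<exists>y. (g has_real_derivative y) (at v) \<and> 0 \<le> y"
        using D[of v] v less_imp_le by blast
    qed (use u in auto)
    then show "Bernstein n m (p - u / (1 + c * u)) \<le> Bernstein n m (p + u)"
      unfolding B g0 by (intro mult_left_mono) (auto simp: g_def)
  }
qed

text \<open>Both branches start at the maximum \<open>p\<close> with slope \<open>0\<close>. This removes the singularity of the weights \<open>1 / u\<close>
  and \<open>1 / \<tau>\<close> at the origin.\<close>

lemma Bernstein_difference_quotient_tendsto:
  fixes p c :: real
  assumes "0 < m" "m < n" and p: "p = real m / real n"
  shows "((\<lambda>u. (Bernstein n m (p + u) - Bernstein n m (p - u / (1 + c * u))) / u) \<longlongrightarrow> 0) (at_right 0)"
proof -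
  have n: "0 < p" "p < 1" "real m - real n * p = 0"
    unfolding p using assms(1,2) by simp_all
  have B: "(Bernstein n m has_real_derivative 0) (at p)"
    using has_real_derivative_Bernstein_log[OF assms(1,2) n(1,2)] n(3) by simp
  have "((\<lambda>u. Bernstein n m (p + u)) has_real_derivative 0 * 1) (at 0)"
    by (rule DERIV_chain2[where g = "\<lambda>u. p + u"]) (use B in \<open>auto intro!: derivative_eq_intros\<close>)
  moreover have "((\<lambda>u. Bernstein n m (p - u / (1 + c * u))) has_real_derivative 0 * (- 1)) (at 0)"
    by (rule DERIV_chain2[where g = "\<lambda>u. p - u / (1 + c * u)"])
      (use B in \<open>auto intro!: derivative_eq_intros\<close>)
  ultimately have "((\<lambda>u. Bernstein n m (p + u) - Bernstein n m (p - u / (1 + c * u)))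
      has_real_derivative 0 * 1 - 0 * (- 1)) (at 0)"
    by (rule DERIV_diff)
  then have "((\<lambda>u. (Bernstein n m (p + u) - Bernstein n m (p - u / (1 + c * u))) / u) \<longlongrightarrow> 0) (at 0)"
    by (simp add: DERIV_def)
  then show ?thesis by (rule filterlim_mono) (auto simp: at_le)
qed

text \<open>The substitution \<open>\<tau> = u / (1 + c u)\<close> satisfies \<open>d\<tau> / \<tau>\<^sup>2 = du / u\<^sup>2\<close>. Hence the derivative of the gap is
  \<open>p q / u\<^sup>2\<close> times the difference of the heights of the two branches, and its sign is
  controlled by the preceding comparison.\<close>

definition excess_gap :: "nat \<Rightarrow> nat \<Rightarrow> real \<Rightarrow> real \<Rightarrow> real" where
  "excess_gap n m c u = tail_excess n m u - tail_excess n (n - m) (u / (1 + c * u))"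

text \<open>Because \<open>1 / \<tau> = 1 / u + c\<close>, the singular parts of the two weights agree and the shift \<open>c\<close> survives as a
  multiple of the height \<open>Bernstein n m p\<close>. The choice of \<open>c\<close> thus tunes the bound that results.\<close>

lemma excess_gap_tendsto:
  assumes "0 < m" "m < n" and p: "p = real m / real n" and q: "q = 1 - p" and c: "0 \<le> c"
  shows "(excess_gap n m c \<longlongrightarrow> bin_cdf n m p - bin_cdf n (n - m) q - (q - p - p * q * c) * Bernstein n m p)
    (at_right 0)"
proof -
  have n: "p > 0" unfolding p using assms(1,2) by simp_all
  have q': "q = real (n - m) / real n" unfolding q p using assms(1,2) by (simp add: of_nat_diff field_simps)
  define t where "t = (\<lambda>u. u / (1 + c * u))"
  define A where "A = (\<lambda>u. Bernstein n m (p + u))"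
  define B where "B = (\<lambda>u. Bernstein n m (p - t u))"
  have t: "(t \<longlongrightarrow> 0) (at_right 0)"
    unfolding t_def by (rule tendsto_eq_intros refl | simp)+
  have iB: "isCont (Bernstein n m) p" for p
    using continuous_on_Bernstein[of UNIV] by (simp add: continuous_on_eq_continuous_at)
  have iF: "isCont (bin_cdf n k) p" for k p
    using continuous_on_bin_cdf[of UNIV] by (simp add: continuous_on_eq_continuous_at)
  have A0: "(A \<longlongrightarrow> Bernstein n m p) (at_right 0)"
    unfolding A_def by (rule isCont_tendsto_compose[OF iB]) (rule tendsto_eq_intros refl | simp)+
  have B0: "(B \<longlongrightarrow> Bernstein n m p) (at_right 0)"
    unfolding B_def by (rule isCont_tendsto_compose[OF iB]) (rule tendsto_eq_intros t refl | simp)+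
  have F0: "((\<lambda>u. bin_cdf n m (p + u)) \<longlongrightarrow> bin_cdf n m p) (at_right 0)"
    by (rule isCont_tendsto_compose[OF iF]) (rule tendsto_eq_intros refl | simp)+
  have H0: "((\<lambda>u. bin_cdf n (n - m) (q + t u)) \<longlongrightarrow> bin_cdf n (n - m) q) (at_right 0)"
    by (rule isCont_tendsto_compose[OF iF]) (rule tendsto_eq_intros t refl | simp)+
  have Q0: "((\<lambda>u. (A u - B u) / u) \<longlongrightarrow> 0) (at_right 0)"
    using Bernstein_difference_quotient_tendsto[OF assms(1-3)] by (simp add: A_def B_def t_def)
  have "((\<lambda>u. bin_cdf n m (p + u) - bin_cdf n (n - m) (q + t u) - q * A u + (p + p * q * c) * B u
      - p * q * ((A u - B u) / u)) \<longlongrightarrow>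
    bin_cdf n m p - bin_cdf n (n - m) q - q * Bernstein n m p + (p + p * q * c) * Bernstein n m p - p * q * 0)
      (at_right 0)"
    by (intro tendsto_intros F0 H0 A0 B0 Q0)
  moreover have "\<forall>\<^sub>F u in at_right 0. bin_cdf n m (p + u) - bin_cdf n (n - m) (q + t u) - q * A u
      + (p + p * q * c) * B u - p * q * ((A u - B u) / u) = excess_gap n m c u"
  proof (rule eventually_at_right_less[THEN eventually_mono])
    fix u :: real assume u: "0 < u"
    have w: "0 < 1 + c * u" using u c by (simp add: add_pos_nonneg)
    have "p * q / t u = p * q / u + p * q * c" using u w by (simp add: t_def field_simps)
    moreover have "Bernstein n (n - m) (q + t u) = B u"
    proof -
      have "q + t u = 1 - (p - t u)" by (simp add: q)
      then show ?thesis
        unfolding B_def using Bernstein_symmetric[of m n "p - t u"] assms(2) by (simp only: less_imp_le)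
    qed
    moreover have "excess_gap n m c u = bin_cdf n m (p + u) - (q + p * q / u) * A u
        - (bin_cdf n (n - m) (q + t u) - (p + p * q / t u) * Bernstein n (n - m) (q + t u))"
      unfolding excess_gap_def tail_excess_def Let_def p[symmetric] q[symmetric] q'[symmetric]
      by (simp add: q A_def t_def mult.commute)
    ultimately show "bin_cdf n m (p + u) - bin_cdf n (n - m) (q + t u) - q * A u
      + (p + p * q * c) * B u - p * q * ((A u - B u) / u) = excess_gap n m c u"
      by (simp add: algebra_simps diff_divide_distrib)
  qed
  ultimately have "(excess_gap n m c \<longlongrightarrow>
    bin_cdf n m p - bin_cdf n (n - m) q - q * Bernstein n m p + (p + p * q * c) * Bernstein n m p - p * q * 0)
      (at_right 0)"
    by (rule Lim_transform_eventually)
  then show ?thesis by (simp add: algebra_simps)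
qed

lemma has_real_derivative_excess_gap:
  assumes "0 < m" "m < n" and p: "p = real m / real n" and q: "q = 1 - p" and c: "0 \<le> c"
    and u: "0 < u" "u < q" and left: "u < p * (1 + c * u)"
  shows "(excess_gap n m c has_real_derivative
      p * q * (Bernstein n m (p + u) - Bernstein n m (p - u / (1 + c * u))) / u\<^sup>2) (at u)"
proof -
  define w where "w = 1 + c * u"
  have w: "0 < w" using u c by (simp add: w_def add_pos_nonneg)
  have q': "q = real (n - m) / real n" unfolding q p using assms(1,2) by (simp add: of_nat_diff field_simps)
  have tau: "0 < u / w" "u / w < p" using w u left by (simp_all add: w_def[symmetric] divide_simps)
  have D1: "(tail_excess n m has_real_derivative p * q * Bernstein n m (p + u) / u\<^sup>2) (at u)"
    by (rule has_real_derivative_tail_excess[OF assms(1,2) p q u])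
  have D2: "(tail_excess n (n - m) has_real_derivative q * p * Bernstein n (n - m) (q + u / w) / (u / w)\<^sup>2) (at (u / w))"
    by (rule has_real_derivative_tail_excess) (use assms(1,2) q' q tau in auto)
  have D3: "((\<lambda>v. v / (1 + c * v)) has_real_derivative 1 / w\<^sup>2) (at u)"
  proof -
    have "1 + c * u \<noteq> 0" using w by (simp add: w_def)
    then have "((\<lambda>v. v / (1 + c * v)) has_real_derivative
        (1 * (1 + c * u) - u * c) / ((1 + c * u) * (1 + c * u))) (at u)"
      by (intro DERIV_divide DERIV_ident) (auto intro!: derivative_eq_intros)
    then show ?thesis by (rule DERIV_cong) (simp add: w_def power2_eq_square mult.commute)
  qed
  have "((\<lambda>v. tail_excess n (n - m) (v / (1 + c * v))) has_real_derivative
      q * p * Bernstein n (n - m) (q + u / w) / (u / w)\<^sup>2 * (1 / w\<^sup>2)) (at u)"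
    by (rule DERIV_chain2[OF _ D3]) (use D2 in \<open>simp add: w_def\<close>)
  from DERIV_diff[OF D1 this]
  show ?thesis unfolding excess_gap_def [abs_def]
  proof (rule DERIV_cong)
    have "Bernstein n (n - m) (q + u / w) = Bernstein n m (p - u / w)"
    proof -
      have "q + u / w = 1 - (p - u / w)" by (simp add: q)
      then show ?thesis using Bernstein_symmetric[of m n "p - u / w"] assms(2) by (simp only: less_imp_le)
    qed
    moreover have "x / (u / w)\<^sup>2 * (1 / w\<^sup>2) = x / u\<^sup>2" for x using w by (simp add: power_divide)
    ultimately show "p * q * Bernstein n m (p + u) / u\<^sup>2
        - q * p * Bernstein n (n - m) (q + u / w) / (u / w)\<^sup>2 * (1 / w\<^sup>2)
      = p * q * (Bernstein n m (p + u) - Bernstein n m (p - u / (1 + c * u))) / u\<^sup>2"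
      by (simp add: w_def[symmetric] right_diff_distrib diff_divide_distrib mult.commute)
  qed
qed

lemma continuous_on_excess_gap:
  assumes "0 < a" "0 \<le> c"
  shows "continuous_on {a..b} (excess_gap n m c)"
proof -
  have "1 + c * x > 0" if "a \<le> x" for x
    using that assms by (intro add_pos_nonneg mult_nonneg_nonneg) auto
  then have *: "x / (1 + c * x) > 0" "1 + c * x \<noteq> 0" if "a \<le> x" for x
    using that assms by (auto simp: less_le)
  have "continuous_on {a..b} (\<lambda>u. tail_excess n (n - m) (u / (1 + c * u)))"
    using assms *
    by (intro continuous_on_compose2[OF continuous_on_tail_excess[of "{0<..}"]] continuous_intros) auto
  then show ?thesis unfolding excess_gap_def [abs_def] using assms(1)
    by (intro continuous_intros continuous_on_tail_excess) auto
qed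

text \<open>With \<open>c = (q - p) / (p q)\<close> the pairing maps \<open>(0, q)\<close> onto \<open>(0, p)\<close>, the correction term vanishes, and the
  two polynomials to be compared differ by the factor \<open>1 + c v \<ge> 1\<close> only. The left branch is therefore the
  higher one, the gap decreases to its value \<open>0\<close> at \<open>u = q\<close>, and its limit at \<open>0\<close> is nonnegative.\<close>

lemma integer_mean_cdf_gap_nonneg:
  assumes "0 < m" "2 * m \<le> n" and p: "p = real m / real n" and q: "q = 1 - p"
  shows "bin_cdf n (n - m) q \<le> bin_cdf n m p"
proof -
  have mn: "m < n" using assms by linarith
  have pq: "0 < p" "p \<le> q" "0 < q" unfolding q p using assms(1,2) by (simp_all add: field_simps)
  define c where "c = (q - p) / (p * q)"
  have c: "0 \<le> c" using pq by (simp add: c_def)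
  have e: "p * (1 + c * v) - v = p * (q - v) / q" "q * (1 + c * v) + v = q * (p + v) / p" for v
    using pq unfolding c_def by (simp_all add: divide_simps) (simp_all add: algebra_simps)
  have left: "v < p * (1 + c * v)" if "v < q" for v
  proof -
    have "0 < p * (q - v) / q" using that pq by simp
    then show ?thesis unfolding e(1)[symmetric] by simp
  qed
  have key: "(p + v) * (q - v) \<le> (1 + c * v) * (p * (1 + c * v) - v) * (q * (1 + c * v) + v)"
    if "0 < v" "v < q" for v
  proof -
    have "(1 + c * v) * (p * (1 + c * v) - v) * (q * (1 + c * v) + v) = (1 + c * v) * ((p + v) * (q - v))"
      unfolding e mult.assoc using pq by simp
    moreover have "1 * ((p + v) * (q - v)) \<le> (1 + c * v) * ((p + v) * (q - v))"
      using that pq c by (intro mult_right_mono mult_nonneg_nonneg) auto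
    ultimately show ?thesis by (simp only: mult_1)
  qed
  have end0: "excess_gap n m c q = 0"
  proof -
    have "q / (1 + c * q) = p" unfolding c_def using pq by (simp add: field_simps)
    moreover have "tail_excess n (n - m) (1 - real (n - m) / real n) = 0"
      using assms(1) mn by (intro tail_excess_end) auto
    moreover have "1 - real (n - m) / real n = p" unfolding p using mn by (simp add: of_nat_diff field_simps)
    moreover have "tail_excess n m q = 0" using tail_excess_end[OF assms(1) mn] p q by simp
    ultimately show ?thesis by (simp add: excess_gap_def)
  qed
  have nonneg: "0 \<le> excess_gap n m c u" if u: "0 < u" "u < q" for u
  proof -
    have "excess_gap n m c q \<le> excess_gap n m c u"
    proof (rule DERIV_nonpos_imp_decreasing_open[where f = "excess_gap n m c"])
      fix v assume v: "u < v" "v < q"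
      have "Bernstein n m (p + v) \<le> Bernstein n m (p - v / (1 + c * v))"
        using v u by (intro Bernstein_mean_shift_bounds(1)[OF assms(1) mn p q _ _ c left] key) auto
      then have "p * q * (Bernstein n m (p + v) - Bernstein n m (p - v / (1 + c * v))) / v\<^sup>2 \<le> 0"
        using pq by (intro divide_nonpos_nonneg mult_nonneg_nonpos) auto
      then show "\<exists>y. (excess_gap n m c has_real_derivative y) (at v) \<and> y \<le> 0"
        using has_real_derivative_excess_gap[OF assms(1) mn p q c _ _ left, of v] u v by auto
    qed (use u c in \<open>auto intro: continuous_on_excess_gap\<close>)
    then show ?thesis by (simp add: end0)
  qed
  have "0 \<le> bin_cdf n m p - bin_cdf n (n - m) q - (q - p - p * q * c) * Bernstein n m p"
  proof (rule tendsto_lowerbound[OF excess_gap_tendsto[OF assms(1) mn p q c]])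
    show "\<forall>\<^sub>F u in at_right 0. 0 \<le> excess_gap n m c u"
      using pq nonneg by (auto simp: eventually_at_right intro!: exI[of _ q])
  qed simp
  moreover have "q - p - p * q * c = 0" using pq by (simp add: c_def)
  ultimately show ?thesis by simp
qed

text \<open>Half of the previous shift reverses the comparison. The left branch is now exhausted already at
  \<open>r = 2 p q \<le> q\<close>; on \<open>[r, q]\<close> only the right branch is left, where its tail excess increases to \<open>0\<close>.
  The gap increases on \<open>(0, r)\<close> to a nonpositive value, and the correction term at \<open>0\<close> is
  \<open>(q - p) / 2 * Bernstein n m p\<close>.\<close>

lemma integer_mean_cdf_gap_le:
  assumes "0 < m" "2 * m \<le> n" and p: "p = real m / real n" and q: "q = 1 - p"
  shows "bin_cdf n m p - bin_cdf n (n - m) q \<le> (q - p) / 2 * Bernstein n m p"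
proof -
  have mn: "m < n" using assms by linarith
  have pq: "0 < p" "p \<le> q" "0 < q" unfolding q p using assms(1,2) by (simp_all add: field_simps)
  define c r where "c = (q - p) / (2 * p * q)" and "r = 2 * p * q"
  have r: "0 < r" "r \<le> q" using pq q by (simp_all add: r_def)
  have c: "0 \<le> c" using pq by (simp add: c_def)
  have e: "p * (1 + c * v) - v = p - v / (2 * q)" "q * (1 + c * v) + v = q + v / (2 * p)" for v
  proof -
    have "p * (1 + c * v) - v = p - v * (p + q) / (2 * q)" "q * (1 + c * v) + v = q + v * (p + q) / (2 * p)"
      using pq(1,3) unfolding c_def by (simp_all add: divide_simps) (simp_all add: algebra_simps)
    then show "p * (1 + c * v) - v = p - v / (2 * q)" "q * (1 + c * v) + v = q + v / (2 * p)"
      by (simp_all add: q)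
  qed
  have left: "v < p * (1 + c * v)" if "v < r" for v
  proof -
    have "0 < p - v / (2 * q)" using that pq by (simp add: r_def field_simps)
    then show ?thesis unfolding e(1)[symmetric] by simp
  qed
  have key: "(1 + c * v) * (p * (1 + c * v) - v) * (q * (1 + c * v) + v) \<le> (p + v) * (q - v)"
    if "0 < v" "v < r" for v
  proof -
    have "(p - v / (2 * q)) * (q + v / (2 * p)) = p * q - v\<^sup>2 / (4 * (p * q))"
      using pq by (simp add: field_simps power2_eq_square)
    then have "(1 + c * v) * (p * (1 + c * v) - v) * (q * (1 + c * v) + v)
        = (1 + c * v) * (p * q - v\<^sup>2 / (4 * (p * q)))"
      unfolding e by (simp add: mult.assoc)
    also have "\<dots> = p * q + c * (p * q) * v - v\<^sup>2 / (4 * (p * q)) - c * v * (v\<^sup>2 / (4 * (p * q)))"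
      by (simp add: distrib_left distrib_right right_diff_distrib mult_ac del: times_divide_eq_right times_divide_eq_left)
    also have "c * (p * q) = (q - p) / 2" using pq by (simp add: c_def)
    also have "p * q + (q - p) / 2 * v - v\<^sup>2 / (4 * (p * q)) - c * v * (v\<^sup>2 / (4 * (p * q)))
        \<le> p * q + (q - p) * v - v\<^sup>2"
    proof -
      have "1 - 4 * (p * q) = (p - q)\<^sup>2" unfolding q by (simp add: power2_eq_square algebra_simps)
      then have "4 * (p * q) \<le> 1" using zero_le_power2[of "p - q"] by linarith
      then have "v\<^sup>2 \<le> v\<^sup>2 / (4 * (p * q))" using pq mult_left_mono[of "4 * (p * q)" 1 "v\<^sup>2"]
        by (simp add: pos_le_divide_eq)
      moreover have "0 \<le> c * v * (v\<^sup>2 / (4 * (p * q)))" using that pq c by simp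
      moreover have "0 \<le> (q - p) * v" using that pq by simp
      ultimately show ?thesis by argo
    qed
    also have "\<dots> = (p + v) * (q - v)" by (simp add: power2_eq_square algebra_simps)
    finally show ?thesis .
  qed
  have end0: "excess_gap n m c r \<le> 0"
  proof -
    have "1 + c * r = 2 * q" using pq(1,3) q by (simp add: c_def r_def)
    then have "r / (1 + c * r) = p" using pq by (simp add: r_def)
    moreover have "tail_excess n (n - m) (1 - real (n - m) / real n) = 0"
      using assms(1) mn by (intro tail_excess_end) auto
    moreover have "1 - real (n - m) / real n = p" unfolding p using mn by (simp add: of_nat_diff field_simps)
    moreover have "tail_excess n m r \<le> tail_excess n m q"
    proof (rule DERIV_nonneg_imp_increasing_open[where f = "tail_excess n m"])
      fix v assume v: "r < v" "v < q"
      have "0 \<le> p * q * Bernstein n m (p + v) / v\<^sup>2"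
        using v r pq q by (intro divide_nonneg_nonneg mult_nonneg_nonneg Bernstein_nonneg) auto
      then show "\<exists>y. (tail_excess n m has_real_derivative y) (at v) \<and> 0 \<le> y"
        using has_real_derivative_tail_excess[OF assms(1) mn p q, of v] v r by auto
    qed (use r in \<open>auto intro: continuous_on_tail_excess\<close>)
    moreover have "tail_excess n m q = 0" using tail_excess_end[OF assms(1) mn] p q by simp
    ultimately show ?thesis by (simp add: excess_gap_def)
  qed
  have nonpos: "excess_gap n m c u \<le> 0" if u: "0 < u" "u < r" for u
  proof -
    have "excess_gap n m c u \<le> excess_gap n m c r"
    proof (rule DERIV_nonneg_imp_increasing_open[where f = "excess_gap n m c"])
      fix v assume v: "u < v" "v < r"
      have "Bernstein n m (p - v / (1 + c * v)) \<le> Bernstein n m (p + v)"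
        using v u r by (intro Bernstein_mean_shift_bounds(2)[OF assms(1) mn p q _ _ c left] key) auto
      then have "0 \<le> p * q * (Bernstein n m (p + v) - Bernstein n m (p - v / (1 + c * v))) / v\<^sup>2"
        using pq by (intro divide_nonneg_nonneg mult_nonneg_nonneg) auto
      then show "\<exists>y. (excess_gap n m c has_real_derivative y) (at v) \<and> 0 \<le> y"
        using has_real_derivative_excess_gap[OF assms(1) mn p q c _ _ left, of v] u v r by auto
    qed (use u c in \<open>auto intro: continuous_on_excess_gap\<close>)
    then show ?thesis using end0 by simp
  qed
  have "bin_cdf n m p - bin_cdf n (n - m) q - (q - p - p * q * c) * Bernstein n m p \<le> 0"
  proof (rule tendsto_upperbound[OF excess_gap_tendsto[OF assms(1) mn p q c]])
    show "\<forall>\<^sub>F u in at_right 0. excess_gap n m c u \<le> 0"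
      using r nonpos by (auto simp: eventually_at_right intro!: exI[of _ r])
  qed simp
  moreover have "q - p - p * q * c = (q - p) / 2" using pq by (simp add: c_def field_simps)
  ultimately show ?thesis by simp
qed

section \<open>From integer means to all means\<close>

text \<open>The number \<open>0.41\<close> is slightly larger than \<open>1 / sqrt (2 pi)\<close>; the constant \<open>0.4690\<close> leaves enough room for it.\<close>

lemma Bernstein_integer_mean_le_sqrt:
  fixes p :: real
  assumes "0 < m" "m < n" and p: "p = real m / real n"
  shows "Bernstein n m p \<le> 0.41 / sqrt (real n * p * (1 - p))"
proof -
  define N where "N = real n * p * (1 - p)"
  have N: "0 < N" using assms by (simp add: N_def)
  have "N \<le> 0.41\<^sup>2 * (2 * pi * N)"
    using N pi_approx(1) mult_right_mono[of 1 "0.41\<^sup>2 * (2 * pi)" N] by (simp add: power2_eq_square)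
  then have "sqrt N \<le> 0.41 * sqrt (2 * pi * N)"
    using real_sqrt_le_mono[of N "0.41\<^sup>2 * (2 * pi * N)"] by (simp add: real_sqrt_mult)
  then have "1 / sqrt (2 * pi * N) \<le> 0.41 / sqrt N" using N by (simp add: field_simps)
  then show ?thesis using Bernstein_integer_mean_le[OF assms] by (simp add: N_def mult.assoc)
qed

lemma integer_mean_cdf_bounds:
  assumes "0 < m" "2 * m \<le> n" and p: "p = real m / real n"
  shows "1 / 2 - bin_cdf n (m - 1) p \<le> Bernstein n m p / 2"
    and "bin_cdf n m p - 1 / 2 \<le> (1 / 2 + (1 - 2 * p) / 4) * Bernstein n m p"
proof -
  have "bin_cdf n m p = bin_cdf n (m - 1) p + Bernstein n m p"
    using assms(1) by (cases m) (auto simp: bin_cdf_def)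
  moreover have "bin_cdf n (n - m) (1 - p) = 1 - bin_cdf n (m - 1) p"
    using bin_cdf_symmetric[of "m - 1" n p] assms by (simp add: Suc_diff_1)
  moreover have "bin_cdf n m p - bin_cdf n (n - m) (1 - p) \<le> Bernstein n m p / 2 - p * Bernstein n m p"
    using integer_mean_cdf_gap_le[OF assms refl] by (simp add: field_simps)
  moreover note integer_mean_cdf_gap_nonneg[OF assms refl]
  moreover have e: "(1 / 2 + (1 - 2 * p) / 4) * b = 3 * b / 4 - p * b / 2" for b
    by (simp add: field_simps)
  ultimately show "1 / 2 - bin_cdf n (m - 1) p \<le> Bernstein n m p / 2"
    "bin_cdf n m p - 1 / 2 \<le> (1 / 2 + (1 - 2 * p) / 4) * Bernstein n m p"
    unfolding e by argo+
qed

text \<open>The probability of \<open>S \<ge> m\<close> increases with the parameter while the bound decreases on \<open>(0, 1/2]\<close>, so the worst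
  parameter is the integer mean \<open>m / n\<close>, where the excess is at most half of \<open>Bernstein n m p\<close>. If
  \<open>m / n > 1/2\<close>, comparison with the symmetric case \<open>1/2\<close> shows that there is no excess.\<close>

lemma half_minus_bin_cdf_le:
  assumes "0 < m" "m \<le> n" and x: "0 < x" "x \<le> 1 / 2" and nx: "real n * x \<le> real m"
  shows "1 / 2 - bin_cdf n (m - 1) x \<le> 0.4690 * ((x\<^sup>2 + (1 - x)\<^sup>2) / sqrt (real n * x * (1 - x)))"
    (is "_ \<le> ?R")
proof (cases "2 * m \<le> n")
  case True
  define p where "p = real m / real n"
  have n: "0 < real n" using assms by simp
  have p: "0 < p" "x \<le> p" "p \<le> 1 / 2" using n nx True assms(1) by (simp_all add: p_def field_simps)
  have v: "x * (1 - x) \<le> p * (1 - p)"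
  proof -
    have "p * (1 - p) - x * (1 - x) = (p - x) * (1 - p - x)" by (simp add: algebra_simps)
    moreover have "0 \<le> (p - x) * (1 - p - x)" using p x by simp
    ultimately show ?thesis by linarith
  qed
  have vx: "0 < x * (1 - x)" using x by simp
  have "1 / 2 - bin_cdf n (m - 1) x \<le> 1 / 2 - bin_cdf n (m - 1) p"
    using bin_cdf_antimono[of x p "m - 1" n] x p assms by simp
  also have "\<dots> \<le> Bernstein n m p / 2"
    by (rule integer_mean_cdf_bounds(1)[OF assms(1) True p_def])
  also have "\<dots> \<le> 0.41 / sqrt (real n * p * (1 - p)) / 2"
    using Bernstein_integer_mean_le_sqrt[OF assms(1) _ p_def] True assms(1) by simp
  also have "\<dots> \<le> 0.2345 / sqrt (real n * p * (1 - p))"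
    using p n divide_right_mono[of "0.205" "0.2345" "sqrt (real n * p * (1 - p))"] by simp
  also have "\<dots> \<le> 0.2345 / sqrt (real n * x * (1 - x))"
    using v vx n by (intro divide_left_mono) (auto simp: mult.assoc intro!: mult_left_mono mult_pos_pos)
  also have "\<dots> \<le> 0.4690 * (x\<^sup>2 + (1 - x)\<^sup>2) / sqrt (real n * x * (1 - x))"
  proof (rule divide_right_mono)
    have "x\<^sup>2 + (1 - x)\<^sup>2 = 1 / 2 + 2 * (x - 1 / 2)\<^sup>2" by (simp add: power2_eq_square algebra_simps)
    then have "1 / 2 \<le> x\<^sup>2 + (1 - x)\<^sup>2" by simp
    then show "0.2345 \<le> 0.4690 * (x\<^sup>2 + (1 - x)\<^sup>2)" by simp
  qed (use x in simp)
  finally show ?thesis by simp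
next
  case False
  have "bin_cdf n (m - 1) (1 / 2) \<le> bin_cdf n (m - 1) x"
    using bin_cdf_antimono[of x "1/2" "m - 1" n] x assms by simp
  moreover have "1 / 2 \<le> bin_cdf n (m - 1) (1 / 2)"
    using False assms by (intro bin_cdf_half_ge) auto
  moreover have "0 \<le> ?R" using x by simp
  ultimately show ?thesis by linarith
qed

text \<open>To the right of \<open>p\<close>, as long as \<open>(p + u) (q - u) \<ge> p q\<close>, the logarithm of the shape falls no faster than the
  parabola of a normal density with variance \<open>n p q\<close>.\<close>

lemma Bernstein_near_mean_ge:
  assumes "0 < m" "m < n" and p: "p = real m / real n" and v: "0 \<le> v" "v \<le> 1 - 2 * p" "p + v < 1"
  shows "Bernstein n m p * (1 - real n * v\<^sup>2 / (2 * p * (1 - p))) \<le> Bernstein n m (p + v)"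
proof -
  define q where "q = 1 - p"
  have n: "real m = real n * p" "0 < p" "0 < q" unfolding q_def p using assms(1,2) by simp_all
  define L where "L = (\<lambda>u. real m * ln (p + u) + real (n - m) * ln (1 - (p + u)))"
  have "L 0 + real n * 0\<^sup>2 / (2 * p * q) \<le> L v + real n * v\<^sup>2 / (2 * p * q)"
  proof (rule DERIV_nonneg_imp_nondecreasing[where f = "\<lambda>v. L v + real n * v\<^sup>2 / (2 * p * q)"])
    fix u assume u: "0 \<le> u" "u \<le> v"
    have "u * u \<le> u * (q - p)" using u v by (intro mult_left_mono) (auto simp: q_def)
    then have le: "p * q \<le> (p + u) * (q - u)" by (simp add: algebra_simps)
    have D1: "(L has_real_derivative - (real n * u / ((p + u) * (q - u)))) (at u)"
      unfolding L_def using u n v assms(2) by (intro has_real_derivative_log_shape) (auto simp: q_def)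
    have D2: "((\<lambda>v. real n * v\<^sup>2 / (2 * p * q)) has_real_derivative real n * u / (p * q)) (at u)"
      using n by (auto intro!: derivative_eq_intros)
    have "real n * u / ((p + u) * (q - u)) \<le> real n * u / (p * q)"
      using le n u by (intro divide_left_mono) (auto intro!: mult_pos_pos order.strict_trans2[OF _ le])
    then show "\<exists>y. ((\<lambda>v. L v + real n * v\<^sup>2 / (2 * p * q)) has_real_derivative y) (at u) \<and> 0 \<le> y"
      using DERIV_add[OF D1 D2] by (intro exI conjI) auto
  qed (use v in simp)
  then have "exp (L 0) * exp (- (real n * v\<^sup>2 / (2 * p * q))) \<le> exp (L v)"
    unfolding exp_add[symmetric] by simp
  moreover have "exp (L 0) * (1 - real n * v\<^sup>2 / (2 * p * q)) \<le> exp (L 0) * exp (- (real n * v\<^sup>2 / (2 * p * q)))"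
    using exp_ge_add_one_self[of "- (real n * v\<^sup>2 / (2 * p * q))"] by (intro mult_left_mono) auto
  ultimately have "exp (L 0) * (1 - real n * v\<^sup>2 / (2 * p * q)) \<le> exp (L v)" by linarith
  then have "real (n choose m) * (exp (L 0) * (1 - real n * v\<^sup>2 / (2 * p * q))) \<le> real (n choose m) * exp (L v)"
    by (rule mult_left_mono) simp
  moreover have "Bernstein n m p = real (n choose m) * exp (L 0)"
    using Bernstein_eq_exp[of m n p] n assms(2) by (simp add: L_def q_def)
  moreover have "Bernstein n m (p + v) = real (n choose m) * exp (L v)"
    using Bernstein_eq_exp[of m n "p + v"] n v assms(2) by (simp add: L_def)
  ultimately show ?thesis by (simp add: q_def mult.assoc)
qed

text \<open>Integrating the preceding lower bound on the density: once the parameter passes an integer mean, the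
  distribution function drops linearly up to a cubic error.\<close>

lemma bin_cdf_past_mean_le:
  assumes "0 < m" "m < n" and p: "p = real m / real n" and u: "0 \<le> u" "p + u \<le> 1 / 2"
  shows "bin_cdf n m (p + u)
    \<le> bin_cdf n m p - Bernstein n m p * (real n * u - (real n * u) ^ 3 / (6 * (real n * p * (1 - p))))"
proof -
  define q b where "q = 1 - p" and "b = Bernstein n m p"
  have n: "real (n - m) = real n * q" "0 < p" "0 < q" "0 < real n"
    unfolding q_def p using assms(1,2) by (simp_all add: of_nat_diff field_simps)
  define K where "K = (\<lambda>v. bin_cdf n m (p + v) + real n * b * (v - real n * v ^ 3 / (6 * p * q)))"
  have "K u \<le> K 0"
  proof (rule DERIV_nonpos_imp_nonincreasing[where f = K])
    fix v assume v: "0 \<le> v" "v \<le> u"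
    have pv: "p + v \<le> 1 / 2" "0 < p + v" "p + v < 1" using v u n by auto
    have qv: "1 - (p + v) = q - v" "0 < q - v" using pv by (auto simp: q_def)
    have s: "((\<lambda>v. p + v) has_real_derivative 1) (at v)" by (auto intro!: derivative_eq_intros)
    have D1: "((\<lambda>v. bin_cdf n m (p + v)) has_real_derivative
        - (real (n - m) * Bernstein n m (p + v) / (1 - (p + v))) * 1) (at v)"
      by (rule DERIV_chain2[where g = "\<lambda>v. p + v", OF _ s])
        (rule has_real_derivative_bin_cdf_Bernstein[OF assms(2) pv(3)])
    have D2: "((\<lambda>v. real n * b * (v - real n * v ^ 3 / (6 * p * q))) has_real_derivative
        real n * b * (1 - real n * v\<^sup>2 / (2 * p * q))) (at v)"
      using n by (auto intro!: derivative_eq_intros simp: field_simps power2_eq_square)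
    have "b * (1 - real n * v\<^sup>2 / (2 * p * q)) \<le> Bernstein n m (p + v)"
      unfolding b_def q_def using v u pv by (intro Bernstein_near_mean_ge[OF assms(1,2) p]) auto
    also have "\<dots> \<le> q / (q - v) * Bernstein n m (p + v)"
      using mult_right_mono[of 1 "q / (q - v)" "Bernstein n m (p + v)"] qv v pv
      by (simp add: Bernstein_nonneg)
    finally have "real n * (b * (1 - real n * v\<^sup>2 / (2 * p * q)))
        \<le> real n * (q / (q - v) * Bernstein n m (p + v))"
      by (rule mult_left_mono) simp
    then have "- (real (n - m) * Bernstein n m (p + v) / (1 - (p + v))) * 1
        + real n * b * (1 - real n * v\<^sup>2 / (2 * p * q)) \<le> 0"
      unfolding n(1) qv(1) by (simp add: mult.assoc)
    then show "\<exists>y. (K has_real_derivative y) (at v) \<and> y \<le> 0"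
      using DERIV_add[OF D1 D2] unfolding K_def by blast
  qed (use u in simp)
  moreover have "real n * b * (u - real n * u ^ 3 / (6 * p * q))
      = b * (real n * u - (real n * u) ^ 3 / (6 * (real n * p * q)))"
    using n by (simp add: field_simps power3_eq_cube)
  then have "K u = bin_cdf n m (p + u) + b * (real n * u - (real n * u) ^ 3 / (6 * (real n * p * q)))"
    by (simp only: K_def)
  moreover have "K 0 = bin_cdf n m p" by (simp add: K_def)
  ultimately show ?thesis unfolding b_def[symmetric] q_def[symmetric] by linarith
qed

text \<open>The numerical core. Here \<open>d = 1 - 2 p\<close> measures the skewness, \<open>v\<close> is the distance of the mean \<open>n x\<close> from
  the integer mean \<open>n p\<close>, and \<open>s\<close> is the reciprocal of the variance \<open>n p (1 - p)\<close>. After multiplication by the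
  standard deviation, the left side bounds the deviation from above and the right side the target from below.\<close>

lemma deviation_polynomial_le:
  fixes d v s :: real
  assumes d: "0 \<le> d" "d \<le> 1" and v: "0 \<le> v" "v \<le> 1" and s: "0 \<le> s" "s * (1 + d) \<le> 2"
  shows "0.41 * (1 / 2 + d / 4 - v + v ^ 3 * s / 6) \<le> 0.2345 * (1 + d\<^sup>2 - v * d * s * (3 - d\<^sup>2) / 2)"
proof -
  have s2: "s \<le> 2" using s d mult_left_mono[of 1 "1 + d" s] by simp
  have "v ^ 3 * s \<le> v * 2"
  proof -
    have "v ^ 3 \<le> v" using v by (simp add: power3_eq_cube mult_le_one mult_left_le_one_le)
    then show ?thesis using v s s2 by (intro mult_mono) auto
  qed
  moreover have "v * d * s * (3 - d\<^sup>2) \<le> v * 2.12"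
  proof -
    \<comment> \<open>The cubic \<open>d^3\<close> lies above its tangent at \<open>0.8\<close>, close to the maximum of \<open>d (3 - d\<^sup>2) / (1 + d)\<close>.\<close>
    have "0 \<le> (d - 0.8)\<^sup>2 * (d + 1.6)" using d by (intro mult_nonneg_nonneg) auto
    also have "\<dots> = d ^ 3 - 1.92 * d + 1.024" by (simp add: power2_eq_square power3_eq_cube field_simps)
    finally have "d * (3 - d\<^sup>2) \<le> 1.06 * (1 + d)"
      using d by (simp add: power2_eq_square power3_eq_cube algebra_simps)
    from mult_left_mono[OF this s(1)] have "s * (d * (3 - d\<^sup>2)) \<le> 1.06 * (s * (1 + d))"
      by (simp only: mult.left_commute)
    also have "\<dots> \<le> 1.06 * 2" using s(2) by simp
    finally have "s * (d * (3 - d\<^sup>2)) \<le> 1.06 * 2" .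
    from mult_left_mono[OF this v(1)] show ?thesis by (simp add: mult_ac)
  qed
  moreover have "0 \<le> 0.2345 * (1 + d\<^sup>2) - 0.205 - 0.1025 * d"
  proof -
    \<comment> \<open>The quadratic is smallest near \<open>d = 0.2186\<close>, where it is still positive.\<close>
    have "0 \<le> 0.2345 * (d - 0.2186)\<^sup>2" by simp
    then show ?thesis using d by (simp add: power2_eq_square algebra_simps)
  qed
  moreover have "0.41 * (1 / 2 + d / 4 - v + a / 6) \<le> 0.2345 * (1 + d\<^sup>2 - b / 2)"
    if "a \<le> v * 2" "b \<le> v * 2.12" "0 \<le> 0.2345 * (1 + d\<^sup>2) - 0.205 - 0.1025 * d" for a b
    using that v by (simp add: field_simps)
  ultimately show ?thesis by blast
qed

text \<open>Here both sides decrease with the parameter, so the integer mean \<open>k / n\<close> is not automatically the worst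
  case. The gain from \<open>bin_cdf_past_mean_le\<close> is weighed against the loss in the target, estimated to first
  order in \<open>x - k / n\<close>.\<close>

lemma bin_cdf_minus_half_le:
  assumes k: "0 < k" "k < n" and x: "x \<le> 1 / 2" and nx: "real k \<le> real n * x" "real n * x \<le> real k + 1"
  shows "bin_cdf n k x - 1 / 2 \<le> 0.4690 * ((x\<^sup>2 + (1 - x)\<^sup>2) / sqrt (real n * x * (1 - x)))"
    (is "_ \<le> ?R")
proof -
  define p q d u v S where "p = real k / real n" and "q = 1 - p" and "d = 1 - 2 * p" and "u = x - p"
    and "v = real n * u" and "S = real n * p * q"
  \<comment> \<open>The standard deviation at \<open>x\<close> is at most \<open>1 + y\<close> times the one at \<open>p\<close>.\<close>
  define s y where "s = 1 / S" and "y = v * d * s / 2"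
  define B where "B = 1 / 2 + d / 4 - v + v ^ 3 * s / 6"
  have n: "0 < real n" using k by simp
  have px: "p \<le> x" using n nx by (simp add: p_def field_simps)
  have p: "0 < p" "p \<le> 1 / 2" using order_trans[OF px x] k n by (auto simp: p_def)
  have kn: "2 * k \<le> n" using p(2) n by (simp add: p_def field_simps)
  have npk: "real n * p = real k" using n by (simp add: p_def)
  have v: "0 \<le> v" "v \<le> 1" using px nx npk n by (auto simp: v_def u_def algebra_simps)
  have d: "0 \<le> d" "d \<le> 1" using p by (auto simp: d_def)
  have q: "q = (1 + d) / 2" "0 < q" using p by (auto simp: q_def d_def)
  have S: "0 < S" "q \<le> S" unfolding S_def npk using q(2) k by simp_all
  have s: "0 < s" "s * (1 + d) \<le> 2" using S q by (auto simp: s_def field_simps)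
  have y: "0 \<le> y" using v d s by (simp add: y_def)
  have x_eq: "x = p + u" by (simp add: u_def)
  have u: "0 \<le> u" "p + u \<le> 1 / 2" using px x by (auto simp: u_def)
  have G: "bin_cdf n k x - 1 / 2 \<le> B * Bernstein n k p"
  proof -
    have "bin_cdf n k x \<le> bin_cdf n k p - Bernstein n k p * (v - v ^ 3 / (6 * S))"
      unfolding x_eq v_def S_def q_def by (rule bin_cdf_past_mean_le[OF k p_def u])
    moreover have "bin_cdf n k p - 1 / 2 \<le> (1 / 2 + d / 4) * Bernstein n k p"
      unfolding d_def by (rule integer_mean_cdf_bounds(2)[OF k(1) kn p_def])
    ultimately show ?thesis by (simp add: B_def s_def algebra_simps)
  qed
  have R: "0.2345 * (1 + d\<^sup>2 - v * d * s * (3 - d\<^sup>2) / 2) / sqrt S \<le> ?R"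
  proof -
    define w where "w = 1 + d\<^sup>2 - d * v * (1 - d\<^sup>2) * s"
    have ninv: "4 / real n = (1 - d\<^sup>2) * s"
      using S n p q(2) by (simp add: s_def S_def d_def q_def field_simps power2_eq_square)
    have "x\<^sup>2 + (1 - x)\<^sup>2 = (1 + (d - 2 * u)\<^sup>2) / 2"
      by (simp add: x_eq d_def power2_eq_square algebra_simps)
    also have "(d - 2 * u)\<^sup>2 = d\<^sup>2 - d * v * (4 / real n) + (2 * u)\<^sup>2"
      using n by (simp add: v_def power2_eq_square algebra_simps)
    finally have num: "w / 2 \<le> x\<^sup>2 + (1 - x)\<^sup>2"
      unfolding ninv by (simp add: w_def mult.assoc)
    have "real n * x * (1 - x) = S + v * d - real n * u\<^sup>2"
      by (simp add: x_eq S_def v_def d_def q_def power2_eq_square algebra_simps)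
    also have "\<dots> \<le> S * (1 + 2 * y)" using S n by (simp add: y_def s_def field_simps)
    also have "\<dots> \<le> S * (1 + y)\<^sup>2" using S by (intro mult_left_mono) (auto simp: power2_eq_square algebra_simps)
    finally have "sqrt (real n * x * (1 - x)) \<le> sqrt (S * (1 + y)\<^sup>2)" by (rule real_sqrt_le_mono)
    then have den: "sqrt (real n * x * (1 - x)) \<le> sqrt S * (1 + y)"
      using y by (simp add: real_sqrt_mult)
    have x0: "0 < sqrt (real n * x * (1 - x))" using n p px x by simp
    have "1 + d\<^sup>2 - v * d * s * (3 - d\<^sup>2) / 2 = w - y * (1 + d\<^sup>2)"
      by (simp add: w_def y_def field_simps)
    also have "\<dots> \<le> (x\<^sup>2 + (1 - x)\<^sup>2) * 2 / (1 + y)"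
    proof -
      have "d\<^sup>2 \<le> 1" using d by (simp add: power_le_one)
      then have "0 \<le> d * v * (1 - d\<^sup>2) * s" using d v s by simp
      then have "y * w \<le> y * (1 + d\<^sup>2)" using y by (intro mult_left_mono) (auto simp: w_def)
      moreover have "0 \<le> y * (y * (1 + d\<^sup>2))" using y by simp
      ultimately have "(w - y * (1 + d\<^sup>2)) * (1 + y) \<le> w" by (simp add: algebra_simps)
      also have "\<dots> \<le> (x\<^sup>2 + (1 - x)\<^sup>2) * 2" using num by simp
      finally show ?thesis using y by (simp add: pos_le_divide_eq)
    qed
    finally have "0.2345 * (1 + d\<^sup>2 - v * d * s * (3 - d\<^sup>2) / 2)
        \<le> 0.2345 * ((x\<^sup>2 + (1 - x)\<^sup>2) * 2 / (1 + y))"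
      by (rule mult_left_mono) simp
    also have "0.2345 * (z * 2 / (1 + y)) = 0.4690 * z / (1 + y)" for z by simp
    finally have "0.2345 * (1 + d\<^sup>2 - v * d * s * (3 - d\<^sup>2) / 2)
        \<le> 0.4690 * (x\<^sup>2 + (1 - x)\<^sup>2) / (1 + y)" .
    then have "0.2345 * (1 + d\<^sup>2 - v * d * s * (3 - d\<^sup>2) / 2) / sqrt S
        \<le> 0.4690 * (x\<^sup>2 + (1 - x)\<^sup>2) / (1 + y) / sqrt S"
      using S by (intro divide_right_mono) auto
    also have "\<dots> \<le> ?R"
    proof -
      have "0.4690 * (x\<^sup>2 + (1 - x)\<^sup>2) / (sqrt S * (1 + y))
          \<le> 0.4690 * (x\<^sup>2 + (1 - x)\<^sup>2) / sqrt (real n * x * (1 - x))"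
        by (rule divide_left_mono[OF den _ mult_pos_pos[OF order.strict_trans2[OF x0 den] x0]]) simp
      then show ?thesis
        by (simp only: divide_divide_eq_left times_divide_eq_right mult.commute[of "sqrt S"])
    qed
    finally show ?thesis .
  qed
  \<comment> \<open>Multiplying the local bound on \<open>Bernstein n k p\<close> by \<open>B\<close> requires \<open>B \<ge> 0\<close>; for \<open>B < 0\<close> the
    deviation is not positive.\<close>
  show ?thesis
  proof (cases "0 \<le> B")
    case True
    have "B * Bernstein n k p \<le> B * (0.41 / sqrt S)"
      unfolding S_def q_def using True
      by (intro mult_left_mono Bernstein_integer_mean_le_sqrt[OF k p_def]) auto
    also have "\<dots> \<le> 0.2345 * (1 + d\<^sup>2 - v * d * s * (3 - d\<^sup>2) / 2) / sqrt S"
      using divide_right_mono[OF deviation_polynomial_le[OF d v less_imp_le[OF s(1)] s(2)], of "sqrt S"] S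
      by (simp add: B_def mult.commute)
    finally show ?thesis using G R by linarith
  next
    case False
    then have "B * Bernstein n k p \<le> 0"
      using p by (intro mult_nonpos_nonneg Bernstein_nonneg) auto
    moreover have "0 \<le> ?R" using p px x by simp
    ultimately show ?thesis using G by linarith
  qed
qed

text \<open>For \<open>x \<le> 1/2\<close> this collects both one-sided bounds; the closed interval for \<open>n x\<close> lets the reflection
  \<open>x \<mapsto> 1 - x\<close>, which exchanges strict and weak inequalities, take care of \<open>x > 1/2\<close>.\<close>

lemma bin_cdf_at_mean_near_half:
  assumes k: "0 < k" "Suc k < n" and x: "0 < x" "x < 1"
    and nx: "real k \<le> real n * x" "real n * x \<le> real k + 1"
  shows "\<bar>bin_cdf n k x - 1 / 2\<bar> \<le> 0.4690 * ((x\<^sup>2 + (1 - x)\<^sup>2) / sqrt (real n * x * (1 - x)))"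
proof -
  have *: "\<bar>bin_cdf n j y - 1 / 2\<bar> \<le> 0.4690 * ((y\<^sup>2 + (1 - y)\<^sup>2) / sqrt (real n * y * (1 - y)))"
    if "0 < j" "j < n" "0 < y" "y \<le> 1 / 2" "real j \<le> real n * y" "real n * y \<le> real j + 1" for j y
    using bin_cdf_minus_half_le[of j n y] half_minus_bin_cdf_le[of "Suc j" n y] that by simp
  show ?thesis
  proof (cases "x \<le> 1 / 2")
    case True
    then show ?thesis using * k x nx by simp
  next
    case False
    define j where "j = n - Suc k"
    have "real j = real n - real k - 1" using k by (simp add: j_def of_nat_diff)
    then have "\<bar>bin_cdf n j (1 - x) - 1 / 2\<bar>
        \<le> 0.4690 * (((1 - x)\<^sup>2 + (1 - (1 - x))\<^sup>2) / sqrt (real n * (1 - x) * (1 - (1 - x))))"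
      using False k x nx by (intro *) (auto simp: j_def algebra_simps)
    moreover have "bin_cdf n k x = 1 - bin_cdf n j (1 - x)"
      unfolding j_def using k by (intro bin_cdf_symmetric) auto
    ultimately show ?thesis by (simp add: add.commute mult_ac abs_minus_commute)
  qed
qed

section \<open>The error decomposition\<close>

lemma jump_removed_bounded:
  assumes "bounded (f ` {0..1})"
  shows "bounded (jump_removed f x ` {0..1})"
proof -
  obtain K where K: "\<forall>y\<in>{0..1}. \<bar>f y\<bar> \<le> K"
    using assms by (auto simp: bounded_iff)
  have "\<bar>jump_removed f x y\<bar> \<le> K + \<bar>right_lim f x\<bar> + \<bar>left_lim f x\<bar>" if "y \<in> {0..1}" for y
    using bspec[OF K that] by (auto simp: jump_removed_def indicator_def)
  then show ?thesis
    by (auto simp: bounded_iff intro!: exI[of _ "K + \<bar>right_lim f x\<bar> + \<bar>left_lim f x\<bar>"])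
qed

lemma sum_Bernstein_above_mean:
  assumes x: "0 < x" "x < 1" and n: "1 \<le> n"
  obtains k where "k < n" "real k \<le> real n * x" "real n * x < real k + 1"
    "(\<Sum>j\<le>n. Bernstein n j x * of_bool (x < real j / real n)) = 1 - bin_cdf n k x"
proof
  define k where "k = nat \<lfloor>real n * x\<rfloor>"
  show k: "real k \<le> real n * x" "real n * x < real k + 1"
    using x by (simp_all add: k_def)
  have "real n * x < real n" using x n by simp
  then show kn: "k < n" using k by simp
  have iff: "x < real j / real n \<longleftrightarrow> k < j" for j
  proof -
    have "x < real j / real n \<longleftrightarrow> real n * x < real j" using n by (simp add: field_simps)
    also have "\<dots> \<longleftrightarrow> k < j" using k by linarith
    finally show ?thesis .
  qed
  have "1 = (\<Sum>j\<le>n. Bernstein n j x * of_bool (j \<le> k) + Bernstein n j x * of_bool (k < j))"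
    unfolding sum_Bernstein[of n x, symmetric] by (intro sum.cong) auto
  also have "\<dots> = (\<Sum>j\<le>n. Bernstein n j x * of_bool (j \<le> k)) + (\<Sum>j\<le>n. Bernstein n j x * of_bool (k < j))"
    by (rule sum.distrib)
  also have "(\<Sum>j\<le>n. Bernstein n j x * of_bool (j \<le> k)) = bin_cdf n k x"
    unfolding bin_cdf_def using kn by (intro sum.mono_neutral_cong_right) auto
  finally show "(\<Sum>j\<le>n. Bernstein n j x * of_bool (x < real j / real n)) = 1 - bin_cdf n k x"
    unfolding iff by simp
qed

text \<open>If \<open>n x < 1\<close> or \<open>n x \<ge> n - 1\<close> the event \<open>S > n x\<close> is \<open>S \<noteq> 0\<close> or \<open>S = n\<close>, and the coefficient is the exact
  deviation; for \<open>n = 1\<close> the two ranges overlap, which only enlarges the coefficient.\<close>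

lemma Bernstein_above_mean_near_half:
  assumes x: "0 < x" "x < 1" and n: "1 \<le> n"
  shows "\<bar>(\<Sum>j\<le>n. Bernstein n j x * of_bool (x < real j / real n)) - 1 / 2\<bar> \<le> coeff_b n x"
proof -
  obtain k where k: "k < n" "real k \<le> real n * x" "real n * x < real k + 1"
    and P: "(\<Sum>j\<le>n. Bernstein n j x * of_bool (x < real j / real n)) = 1 - bin_cdf n k x"
    by (rule sum_Bernstein_above_mean[OF assms])
  have n0: "0 < real n" using n by simp
  define A B C where "A = \<bar>1 / 2 - (1 - x) ^ n\<bar> * indicator {0<..<1 / real n} x"
    and "B = \<bar>1 / 2 - x ^ n\<bar> * indicator {(real n - 1) / real n..<1} x"
    and "C = 0.4690 * ((x\<^sup>2 + (1 - x)\<^sup>2) / sqrt (real n * x * (1 - x)))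
       * indicator {1 / real n..<(real n - 1) / real n} x"
  have nn: "0 \<le> A" "0 \<le> B" "0 \<le> C" using x by (simp_all add: A_def B_def C_def)
  have b: "coeff_b n x = A + B + C" by (simp add: coeff_b_def A_def B_def C_def)
  consider "k = 0" | "Suc k = n" | "0 < k" "Suc k < n" using k by linarith
  then have "\<bar>1 - bin_cdf n k x - 1 / 2\<bar> \<le> A + B + C"
  proof cases
    case 1
    then have "x < 1 / real n" using k n0 by (simp add: field_simps)
    then have "A = \<bar>1 / 2 - (1 - x) ^ n\<bar>" using x by (simp add: A_def)
    moreover have "bin_cdf n k x = (1 - x) ^ n" using 1 by (simp add: bin_cdf_def Bernstein_def)
    ultimately show ?thesis using nn by simp
  next
    case 2
    then have "real n - 1 \<le> real n * x" using k by auto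
    then have "(real n - 1) / real n \<le> x" using n0 by (simp add: field_simps)
    then have "B = \<bar>1 / 2 - x ^ n\<bar>" using x by (simp add: B_def)
    moreover have "bin_cdf n k x + x ^ n = (\<Sum>j\<le>n. Bernstein n j x)"
      unfolding bin_cdf_def 2[symmetric] by (simp add: Bernstein_def del: sum_Bernstein)
    ultimately show ?thesis using nn by simp
  next
    case 3
    then have "real k + 1 \<le> real n - 1" "1 \<le> real k" by auto
    then have "1 \<le> real n * x" "real n * x < real n - 1" using k by linarith+
    then have "1 / real n \<le> x" "x < (real n - 1) / real n" using n0 by (simp_all add: field_simps)
    then have "C = 0.4690 * ((x\<^sup>2 + (1 - x)\<^sup>2) / sqrt (real n * x * (1 - x)))" by (simp add: C_def)
    moreover have "\<bar>bin_cdf n k x - 1 / 2\<bar> \<le> 0.4690 * ((x\<^sup>2 + (1 - x)\<^sup>2) / sqrt (real n * x * (1 - x)))"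
      using k 3 x by (intro bin_cdf_at_mean_near_half) auto
    ultimately show ?thesis using nn by linarith
  qed
  then show ?thesis unfolding P b by simp
qed

lemma Bernstein_at_mean_le_coeff_a:
  assumes x: "0 < x" "x < 1" and n: "1 \<le> n"
  shows "(\<Sum>j\<le>n. Bernstein n j x * of_bool (real j / real n = x)) \<le> coeff_a n x"
proof (cases "\<exists>m\<le>n. real m / real n = x")
  case True
  then obtain m where m: "m \<le> n" "x = real m / real n" by auto
  have m1: "0 < m" "m < n" using x n m by (auto simp: field_simps)
  have "(\<Sum>j\<le>n. Bernstein n j x * of_bool (real j / real n = x)) = (\<Sum>j\<in>{m}. Bernstein n j x)"
    using n m by (intro sum.mono_neutral_cong_right) auto
  moreover have "x \<in> (\<lambda>k. real k / real n) ` {1..n - 1}" using m m1 by auto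
  ultimately show ?thesis using Bernstein_integer_mean_le[OF m1 m(2)] by (simp add: coeff_a_def)
next
  case False
  then have "(\<Sum>j\<le>n. Bernstein n j x * of_bool (real j / real n = x)) = 0" by auto
  then show ?thesis using x by (simp add: coeff_a_def)
qed

lemma bernstein_op_decomposition:
  assumes x: "0 < x" "x < 1" and n: "1 \<le> n"
  shows "bernstein_op n f x - (right_lim f x + left_lim f x) / 2
    = bernstein_op n (jump_removed f x) x
      + (f x - left_lim f x) * (\<Sum>j\<le>n. Bernstein n j x * of_bool (real j / real n = x))
      + (right_lim f x - left_lim f x) * ((\<Sum>j\<le>n. Bernstein n j x * of_bool (x < real j / real n)) - 1 / 2)"
proof -
  have "f (real j / real n) = jump_removed f x (real j / real n) + left_lim f x
      + (f x - left_lim f x) * of_bool (real j / real n = x)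
      + (right_lim f x - left_lim f x) * of_bool (x < real j / real n)" if "j \<le> n" for j
  proof -
    have "real j / real n \<le> 1" "0 \<le> real j / real n" using that n by auto
    then show ?thesis
      by (cases x "real j / real n" rule: linorder_cases) (auto simp: jump_removed_def indicator_def)
  qed
  then have "bernstein_op n f x = (\<Sum>j\<le>n. jump_removed f x (real j / real n) * Bernstein n j x
      + left_lim f x * Bernstein n j x
      + (f x - left_lim f x) * (Bernstein n j x * of_bool (real j / real n = x))
      + (right_lim f x - left_lim f x) * (Bernstein n j x * of_bool (x < real j / real n)))"
    unfolding bernstein_op_def by (intro sum.cong refl) (simp only: atMost_iff distrib_right distrib_left mult_ac)
  also have "\<dots> = bernstein_op n (jump_removed f x) x + left_lim f x
      + (f x - left_lim f x) * (\<Sum>j\<le>n. Bernstein n j x * of_bool (real j / real n = x))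
      + (right_lim f x - left_lim f x) * (\<Sum>j\<le>n. Bernstein n j x * of_bool (x < real j / real n))"
    by (simp add: sum.distrib sum_distrib_left[symmetric] bernstein_op_def)
  finally show ?thesis by (simp add: field_simps)
qed

theorem corollary5p4:
  fixes x :: real and f g :: "real \<Rightarrow> real" and n :: nat
  assumes "0 < x" and "x < 1"
    and "f \<in> one_sided_limit_space x"
    and "g = jump_removed f x"
    and "n \<ge> 1"
  shows "\<bar>bernstein_op n f x - (right_lim f x + left_lim f x) / 2\<bar>
    \<le> coeff_a n x * \<bar>f x - left_lim f x\<bar> + coeff_b n x * \<bar>right_lim f x - left_lim f x\<bar>
      + 2 * exp (x * (1 - x) / 2
                  * (1 + (x\<^sup>2 + (1 - x)\<^sup>2) / (3 * sqrt (real n)) * exp (1 / sqrt (real n))))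
        * (1 / real n * (\<Sum>k = 0..<n. modulus_at_ext g x (ereal (1 / sqrt (real n)) * log_ratio n k)))"
proof -
  define P0 P1 where "P0 = (\<Sum>j\<le>n. Bernstein n j x * of_bool (real j / real n = x))"
    and "P1 = (\<Sum>j\<le>n. Bernstein n j x * of_bool (x < real j / real n)) - 1 / 2"
  have "bounded (f ` {0..1})" using assms(3) by (simp add: one_sided_limit_space_def)
  then have bd: "bounded (g ` {0..1})" unfolding assms(4) by (rule jump_removed_bounded)
  have gx: "g x = 0" by (simp add: assms(4) jump_removed_def)
  have "0 \<le> P0" unfolding P0_def using assms(1,2) by (intro sum_nonneg) (simp add: Bernstein_nonneg)
  then have "\<bar>(f x - left_lim f x) * P0\<bar> \<le> coeff_a n x * \<bar>f x - left_lim f x\<bar>"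
    using Bernstein_at_mean_le_coeff_a[OF assms(1,2,5), folded P0_def]
    by (simp add: abs_mult mult.commute mult_right_mono)
  moreover have "\<bar>(right_lim f x - left_lim f x) * P1\<bar> \<le> coeff_b n x * \<bar>right_lim f x - left_lim f x\<bar>"
    using Bernstein_above_mean_near_half[OF assms(1,2,5), folded P1_def]
    by (simp add: abs_mult mult.commute mult_right_mono)
  moreover note bernstein_op_modulus_bound[OF bd gx less_imp_le[OF assms(1)] less_imp_le[OF assms(2)] assms(5)]
  moreover have "bernstein_op n f x - (right_lim f x + left_lim f x) / 2
      = bernstein_op n g x + (f x - left_lim f x) * P0 + (right_lim f x - left_lim f x) * P1"
    unfolding P0_def P1_def assms(4) by (rule bernstein_op_decomposition[OF assms(1,2,5)])
  ultimately show ?thesis by linarith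
qed

end
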